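(* There exists a solution $u$ to the obstacle problem in $B_1$ with Lipschitz obstacle such that $u\in W^{2,1}$ but $(D^2u)_+\notin L^p(B_1)$ for any $p>1$.
   Context: $B_1$ denotes the unit ball of $\mathbb{R}^n$, and $W^{2,1}$ is the Sobolev space on $B_1$. The obstacle problem: given a boundary datum $g\in W^{1,2}(B_1)$ and an obstacle $\phi\in W^{1,2}(B_1)$, a solution is the minimizer of $$\min_{w\in\mathcal{A}(\phi)}\int_{B_1}|\nabla w|^2,\qquad \mathcal{A}(\phi)=\{w\in W^{1,2}(B_1): w-g\in W^{1,2}_0(B_1)\ \text{and}\ w\ge\phi\ \text{in}\ B_1\}.$$ "With Lipschitz obstacle" means that $\phi$ is Lipschitz in $B_1$. For a symmetric matrix $M=ODO^T$ with $O$ orthogonal and $D$ diagonal, its positive part is $M_+=OD_+O^T$, where $D_+$ is the entrywise positive part of $D$; $(D^2u)_+$ is the positive part of the Hessian, taken pointwise a.e.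
   Formalization: The dimension is taken to be n ≥ 2; for n = 1 the claim is false, since a solution is superharmonic, so u'' ≤ 0 and (u'')_+ = 0 lies in every L^p. *)

theory Defs
  imports "HOL-Analysis.Analysis"
begin

text \<open>
  Elements of Lebesgue and Sobolev spaces are represented by functions on the whole space, of which
  only the values on the domain \<open>S\<close> matter. Two functions that agree almost everywhere on \<open>S\<close>
  represent the same element. Vectors and matrices carry the Euclidean (Frobenius) norm.
\<close>

definition Lp_space :: "real \<Rightarrow> (real^'n) set \<Rightarrow> (real^'n \<Rightarrow> 'b::euclidean_space) set" where
  "Lp_space p S = {f \<in> borel_measurable (lebesgue_on S).
     integrable (lebesgue_on S) (\<lambda>x. norm (f x) powr p)}"

definition locally_integrable :: "(real^'n) set \<Rightarrow> (real^'n \<Rightarrow> 'b::euclidean_space) \<Rightarrow> bool" where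
  "locally_integrable S f \<longleftrightarrow> (\<forall>K. compact K \<and> K \<subseteq> S \<longrightarrow> f absolutely_integrable_on K)"

definition partial :: "'n \<Rightarrow> (real^'n \<Rightarrow> real) \<Rightarrow> real^'n \<Rightarrow> real" where
  "partial i f x = frechet_derivative f (at x) (axis i 1)"

primrec Ck :: "nat \<Rightarrow> (real^'n \<Rightarrow> real) \<Rightarrow> bool" where
  "Ck 0 f \<longleftrightarrow> continuous_on UNIV f"
| "Ck (Suc k) f \<longleftrightarrow> f differentiable_on UNIV \<and> (\<forall>i. Ck k (partial i f))"

definition test_functions :: "(real^'n) set \<Rightarrow> (real^'n \<Rightarrow> real) set" where
  "test_functions S = {\<psi>. (\<forall>k. Ck k \<psi>) \<and> (\<exists>K. compact K \<and> K \<subseteq> S \<and> (\<forall>x. x \<notin> K \<longrightarrow> \<psi> x = 0))}"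

definition has_weak_gradient ::
  "(real^'n) set \<Rightarrow> (real^'n \<Rightarrow> real) \<Rightarrow> (real^'n \<Rightarrow> real^'n) \<Rightarrow> bool" where
  "has_weak_gradient S u V \<longleftrightarrow> locally_integrable S u \<and> locally_integrable S V \<and>
     (\<forall>\<psi>\<in>test_functions S. \<forall>i.
        (LINT x|lebesgue_on S. u x * partial i \<psi> x) = - (LINT x|lebesgue_on S. V x $ i * \<psi> x))"

definition has_weak_hessian ::
  "(real^'n) set \<Rightarrow> (real^'n \<Rightarrow> real) \<Rightarrow> (real^'n \<Rightarrow> real^'n^'n) \<Rightarrow> bool" where
  "has_weak_hessian S u H \<longleftrightarrow> locally_integrable S u \<and> locally_integrable S H \<and>
     (\<forall>\<psi>\<in>test_functions S. \<forall>i j.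
        (LINT x|lebesgue_on S. u x * partial i (partial j \<psi>) x) =
        (LINT x|lebesgue_on S. H x $ i $ j * \<psi> x))"

text \<open>
  On an open set weak derivatives are unique up to null sets, so the choices below only fix a
  representative.
\<close>

definition weak_gradient :: "(real^'n) set \<Rightarrow> (real^'n \<Rightarrow> real) \<Rightarrow> real^'n \<Rightarrow> real^'n" where
  "weak_gradient S u = (SOME V. has_weak_gradient S u V)"

definition weak_hessian :: "(real^'n) set \<Rightarrow> (real^'n \<Rightarrow> real) \<Rightarrow> real^'n \<Rightarrow> real^'n^'n" where
  "weak_hessian S u = (SOME H. has_weak_hessian S u H)"

definition W1 :: "real \<Rightarrow> (real^'n) set \<Rightarrow> (real^'n \<Rightarrow> real) set" where
  "W1 p S = {u \<in> Lp_space p S. \<exists>V\<in>Lp_space p S. has_weak_gradient S u V}"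

definition W2 :: "real \<Rightarrow> (real^'n) set \<Rightarrow> (real^'n \<Rightarrow> real) set" where
  "W2 p S = {u \<in> W1 p S. \<exists>H\<in>Lp_space p S. has_weak_hessian S u H}"

definition W1_norm :: "real \<Rightarrow> (real^'n) set \<Rightarrow> (real^'n \<Rightarrow> real) \<Rightarrow> real" where
  "W1_norm p S u = ((LINT x|lebesgue_on S. \<bar>u x\<bar> powr p) +
     (LINT x|lebesgue_on S. norm (weak_gradient S u x) powr p)) powr (1 / p)"

definition W1_0 :: "real \<Rightarrow> (real^'n) set \<Rightarrow> (real^'n \<Rightarrow> real) set" where
  "W1_0 p S = {u \<in> W1 p S. \<exists>\<psi>. (\<forall>k::nat. \<psi> k \<in> test_functions S) \<and>
     (\<lambda>k. W1_norm p S (\<lambda>x. u x - \<psi> k x)) \<longlonglongrightarrow> 0}"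

definition admissible ::
  "(real^'n) set \<Rightarrow> (real^'n \<Rightarrow> real) \<Rightarrow> (real^'n \<Rightarrow> real) \<Rightarrow> (real^'n \<Rightarrow> real) set" where
  "admissible S g \<phi> = {w \<in> W1 2 S. (\<lambda>x. w x - g x) \<in> W1_0 2 S \<and>
     (AE x in lebesgue_on S. \<phi> x \<le> w x)}"

definition dirichlet_energy :: "(real^'n) set \<Rightarrow> (real^'n \<Rightarrow> real) \<Rightarrow> real" where
  "dirichlet_energy S w = (LINT x|lebesgue_on S. (norm (weak_gradient S w x))\<^sup>2)"

definition obstacle_solution ::
  "(real^'n) set \<Rightarrow> (real^'n \<Rightarrow> real) \<Rightarrow> (real^'n \<Rightarrow> real) \<Rightarrow> (real^'n \<Rightarrow> real) \<Rightarrow> bool" where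
  "obstacle_solution S g \<phi> u \<longleftrightarrow> g \<in> W1 2 S \<and> \<phi> \<in> W1 2 S \<and>
     is_arg_min (dirichlet_energy S) (\<lambda>w. w \<in> admissible S g \<phi>) u"

definition diag_matrix :: "real^'n \<Rightarrow> real^'n^'n" where
  "diag_matrix d = (\<chi> i j. if i = j then d $ i else 0)"

text \<open>
  The description is independent of the chosen diagonalisation (see the lemma below), and it is
  meaningful for symmetric matrices only. A weak Hessian is symmetric almost everywhere.
\<close>

definition matrix_pos_part :: "real^'n^'n \<Rightarrow> real^'n^'n" where
  "matrix_pos_part M = (THE P. \<exists>Q d. orthogonal_matrix Q \<and>
     M = Q ** diag_matrix d ** transpose Q \<and>
     P = Q ** diag_matrix (\<chi> i. max 0 (d $ i)) ** transpose Q)"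

lemma diag_matrix_mult_left: "(diag_matrix d ** A) $ i $ j = d $ i * A $ i $ j"
  by (simp add: diag_matrix_def matrix_matrix_mult_def if_distrib[of "\<lambda>x. x * _"] cong: if_cong)

lemma diag_matrix_mult_right: "(A ** diag_matrix d) $ i $ j = A $ i $ j * d $ j"
  by (simp add: diag_matrix_def matrix_matrix_mult_def if_distrib[of "\<lambda>x. _ * x"] cong: if_cong)

lemma matrix_pos_part_diagonalisation:
  fixes Q :: "real^'n^'n"
  assumes Q: "orthogonal_matrix Q"
  shows "matrix_pos_part (Q ** diag_matrix d ** transpose Q) =
    Q ** diag_matrix (\<chi> i. max 0 (d $ i)) ** transpose Q"
proof -
  have unique: "Q ** diag_matrix (\<chi> i. max 0 (d $ i)) ** transpose Q =
      R ** diag_matrix (\<chi> i. max 0 (e $ i)) ** transpose R"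
    if R: "orthogonal_matrix R"
      and eq: "Q ** diag_matrix d ** transpose Q = R ** diag_matrix e ** transpose R" for R e
  proof -
    have QQ: "transpose Q ** Q = mat 1" "Q ** transpose Q = mat 1"
      and RR: "transpose R ** R = mat 1" "R ** transpose R = mat 1"
      using Q R by (auto simp: orthogonal_matrix_def)
    define T where "T = transpose Q ** R"
    have "diag_matrix d ** T = transpose Q ** (Q ** diag_matrix d ** transpose Q) ** R"
      by (simp add: T_def matrix_mul_assoc QQ)
    also have "\<dots> = transpose Q ** (R ** diag_matrix e ** transpose R) ** R"
      by (simp only: eq)
    also have "\<dots> = T ** diag_matrix e ** (transpose R ** R)"
      by (simp only: T_def matrix_mul_assoc)
    finally have "diag_matrix d ** T = T ** diag_matrix e"
      by (simp add: RR)
    then have "d $ i * T $ i $ j = T $ i $ j * e $ j" for i j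
      by (metis diag_matrix_mult_left diag_matrix_mult_right)
    then have "T $ i $ j = 0 \<or> d $ i = e $ j" for i j
      by (metis mult.commute mult_left_cancel)
    then have "diag_matrix (\<chi> i. max 0 (d $ i)) ** T = T ** diag_matrix (\<chi> i. max 0 (e $ i))"
      by (simp add: vec_eq_iff diag_matrix_mult_left diag_matrix_mult_right) (metis mult.commute)
    then have "Q ** (diag_matrix (\<chi> i. max 0 (d $ i)) ** T) ** transpose R =
        Q ** (T ** diag_matrix (\<chi> i. max 0 (e $ i))) ** transpose R"
      by simp
    moreover have "Q ** (D ** T) ** transpose R = Q ** D ** transpose Q" for D :: "real^'n^'n"
      unfolding T_def by (metis RR(2) matrix_mul_assoc matrix_mul_rid)
    moreover have "Q ** (T ** E) ** transpose R = R ** E ** transpose R" for E :: "real^'n^'n"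
      unfolding T_def by (metis QQ(2) matrix_mul_assoc matrix_mul_lid)
    ultimately show ?thesis
      by simp
  qed
  show ?thesis
    unfolding matrix_pos_part_def by (rule the_equality) (use Q unique in metis)+
qed

end

theory Submission
  imports Defs "HOL-Computational_Algebra.Polynomial" "HOL-Real_Asymp.Real_Asymp"
begin

text \<open>
  A superharmonic function \<open>u\<close> solves the obstacle problem whose obstacle and boundary datum are
  \<open>u\<close> itself, because every competitor lies above \<open>u\<close> and moving up from a superharmonic function
  costs energy (\<open>obstacle_solution_self\<close>, \<open>superharmonic_pairing_nonneg\<close>). It therefore suffices
  to find a Lipschitz superharmonic function in \<open>W\<^sup>2\<^sup>,\<^sup>1\<close> for which the positive part of the Hessian is
  in no \<open>L\<^sup>p\<close> with \<open>p > 1\<close>.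

  With \<open>x\<close> and \<open>y\<close> two coordinates, the building block is the layer
  \<open>- (M sqrt (r\<^sup>2 + x\<^sup>2) + r w(x/r) cos (y/r))\<close>, where \<open>w\<close> is a cutoff that is 1 for \<open>\<bar>x\<bar> < r\<close> and 0
  for \<open>\<bar>x\<bar> > 2 r\<close>. It is a smoothed concave wedge with a corrugation of
  amplitude and period \<open>r\<close>. The concavity of the wedge across \<open>x = 0\<close> is of order \<open>M/r\<close> and
  pays for the corrugation, so the layer is superharmonic for large \<open>M\<close>; its gradient is bounded and
  its Hessian is of size \<open>1/r\<close> on a slab of width \<open>r\<close> and decays like \<open>r\<^sup>2 / \<bar>x\<bar>\<^sup>3\<close> away from it,
  hence is bounded in \<open>L\<^sup>1\<close>, all uniformly in \<open>r\<close>.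
  Nevertheless the second derivative in \<open>y\<close> is at least of order \<open>1/r\<close> on a fixed fraction of that
  slab.

  Now \<open>u\<close> is the sum of the layers of radius \<open>r\<^sub>k = 8 powr (- k\<^sup>2)\<close> with weights
  \<open>c\<^sub>k = 2 powr (- k)\<close>. The uniform bounds and the summability of the weights give the Lipschitz
  property, \<open>W\<^sup>2\<^sup>,\<^sup>1\<close> regularity and superharmonicity (locale \<open>superharmonic_series\<close>). For \<open>x\<close> in
  \<open>(2 r\<^sub>k\<^sub>+\<^sub>1, r\<^sub>k)\<close> all coarser cutoffs are 1 and all finer ones are 0, so the Hessian is diagonal,
  and its entry in the direction \<open>y\<close> is dominated by layer \<open>k\<close>: it is at least of order \<open>c\<^sub>k / r\<^sub>k\<close>
  on a set of volume of order \<open>r\<^sub>k\<close> (\<open>norm_pos_part_ge\<close>, \<open>cosine_set_measure\<close>). Since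
  \<open>c\<^sub>k\<^sup>p r\<^sub>k\<^sup>1\<^sup>-\<^sup>p\<close> tends to infinity for every \<open>p > 1\<close>, the positive part is not in \<open>L\<^sup>p\<close>
  (\<open>pos_part_not_Lp\<close>). Weak derivatives are unique up to null sets (\<open>fundamental_lemma\<close>), so this
  holds for the chosen weak Hessian.
\<close>

section \<open>Gradients and integration by parts\<close>

definition has_C1_gradient :: "(real^'n \<Rightarrow> real) \<Rightarrow> (real^'n \<Rightarrow> real^'n) \<Rightarrow> bool" where
  "has_C1_gradient f V \<longleftrightarrow>
     (\<forall>z. (f has_derivative (\<lambda>h. V z \<bullet> h)) (at z)) \<and> continuous_on UNIV V"

lemma has_gradient_partial:
  assumes "has_C1_gradient f V"
  shows "partial i f z = V z $ i"
proof -
  have "(f has_derivative (\<lambda>h. V z \<bullet> h)) (at z)"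
    using assms by (simp add: has_C1_gradient_def)
  then have "frechet_derivative f (at z) = (\<lambda>h. V z \<bullet> h)"
    by (rule frechet_derivative_at[symmetric])
  then show ?thesis
    by (simp add: partial_def cart_eq_inner_axis)
qed

lemma has_gradient_continuous:
  assumes "has_C1_gradient f V"
  shows "continuous_on A f" "continuous_on A V"
proof -
  have "isCont f z" for z
    using assms has_derivative_continuous unfolding has_C1_gradient_def by blast
  then show "continuous_on A f"
    by (simp add: continuous_at_imp_continuous_on)
  show "continuous_on A V"
    using assms continuous_on_subset[OF _ subset_UNIV] unfolding has_C1_gradient_def by blast
qed

lemma has_gradient_component_continuous:
  assumes "has_C1_gradient f V"
  shows "continuous_on A (\<lambda>x. V x $ i)"
  using has_gradient_continuous(2)[OF assms] by (intro continuous_intros)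

lemma has_gradient_mult:
  assumes "has_C1_gradient f V" "has_C1_gradient g W"
  shows "has_C1_gradient (\<lambda>x. f x * g x) (\<lambda>x. f x *\<^sub>R W x + g x *\<^sub>R V x)"
proof -
  have "((\<lambda>x. f x * g x) has_derivative (\<lambda>h. (f z *\<^sub>R W z + g z *\<^sub>R V z) \<bullet> h)) (at z)" for z
  proof -
    have "((\<lambda>x. f x * g x) has_derivative (\<lambda>h. f z * (W z \<bullet> h) + (V z \<bullet> h) * g z)) (at z)"
      using assms by (intro has_derivative_mult) (auto simp: has_C1_gradient_def)
    then show ?thesis
      by (simp add: inner_add_left mult.commute)
  qed
  moreover have "continuous_on UNIV (\<lambda>x. f x *\<^sub>R W x + g x *\<^sub>R V x)"
    using has_gradient_continuous[OF assms(1)] has_gradient_continuous[OF assms(2)]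
    by (intro continuous_intros)
  ultimately show ?thesis
    by (simp add: has_C1_gradient_def)
qed

lemma has_gradient_zero_outside:
  assumes "has_C1_gradient f V" "closed K" "\<And>x. x \<notin> K \<Longrightarrow> f x = 0" "x \<notin> K"
  shows "V x = 0"
proof -
  have "(f has_derivative (\<lambda>h. 0)) (at x)"
    by (rule has_derivative_transform_within_open[where f="\<lambda>_. 0" and s="- K"])
       (use assms in \<open>auto simp: open_Compl\<close>)
  moreover have "(f has_derivative (\<lambda>h. V x \<bullet> h)) (at x)"
    using assms by (simp add: has_C1_gradient_def)
  ultimately have "(\<lambda>h. V x \<bullet> h) = (\<lambda>h. 0)"
    by (rule has_derivative_unique[rotated])
  then show ?thesis
    by (metis inner_eq_zero_iff)
qed

lemma Ck_Suc_imp_Ck: "Ck (Suc k) f \<Longrightarrow> Ck k f"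
proof (induction k arbitrary: f)
  case 0
  then show ?case
    by (simp add: differentiable_imp_continuous_on)
next
  case (Suc k)
  then show ?case
    by auto
qed

lemma Ck_1_has_gradient:
  assumes "Ck (Suc 0) f"
  shows "has_C1_gradient f (\<lambda>z. \<chi> i. partial i f z)"
proof -
  have "(f has_derivative (\<lambda>h. (\<chi> i. partial i f z) \<bullet> h)) (at z)" for z
  proof -
    have d: "(f has_derivative frechet_derivative f (at z)) (at z)"
      using assms by (simp add: differentiable_on_def frechet_derivative_works)
    interpret L: bounded_linear "frechet_derivative f (at z)"
      using d by (rule has_derivative_bounded_linear)
    have "frechet_derivative f (at z) h = (\<chi> i. partial i f z) \<bullet> h" for h
    proof -
      have "frechet_derivative f (at z) h = frechet_derivative f (at z) (\<Sum>i\<in>UNIV. h $ i *\<^sub>R axis i 1)"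
        using basis_expansion[of h] by (simp add: scalar_mult_eq_scaleR)
      also have "\<dots> = (\<Sum>i\<in>UNIV. h $ i * frechet_derivative f (at z) (axis i 1))"
        by (simp add: L.sum L.scaleR)
      finally show ?thesis
        by (simp add: inner_vec_def partial_def mult.commute)
    qed
    then show ?thesis
      using d by presburger
  qed
  moreover have "continuous_on UNIV (\<lambda>z. \<chi> i. partial i f z)"
    using assms by (intro continuous_on_vec_lambda) auto
  ultimately show ?thesis
    by (simp add: has_C1_gradient_def)
qed

lemma test_function_has_gradient:
  assumes "\<psi> \<in> test_functions S"
  shows "has_C1_gradient \<psi> (\<lambda>z. \<chi> i. partial i \<psi> z)"
  using assms Ck_1_has_gradient unfolding test_functions_def by blast

lemma partial_test_function:
  assumes "\<psi> \<in> test_functions S"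
  shows "partial j \<psi> \<in> test_functions S"
proof -
  obtain K where K: "compact K" "K \<subseteq> S" "\<And>x. x \<notin> K \<Longrightarrow> \<psi> x = 0"
    using assms by (auto simp: test_functions_def)
  have "partial j \<psi> x = 0" if "x \<notin> K" for x
  proof -
    have "(\<chi> i. partial i \<psi> x) = 0"
      using has_gradient_zero_outside[OF test_function_has_gradient[OF assms], of K x] K that
      by (auto simp: compact_imp_closed)
    then show ?thesis
      by (simp add: vec_eq_iff)
  qed
  moreover have "Ck k (partial j \<psi>)" for k
    using assms unfolding test_functions_def by (metis (mono_tags, lifting) Ck.simps(2) mem_Collect_eq)
  ultimately show ?thesis
    using K by (auto simp: test_functions_def)
qed

lemma integrable_continuous_compact_support:
  fixes f :: "real^'n \<Rightarrow> 'b::euclidean_space"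
  assumes "continuous_on UNIV f" "compact K" "\<And>x. x \<notin> K \<Longrightarrow> f x = 0"
  shows "integrable lborel f"
proof -
  have "integrable lborel (\<lambda>x. indicator K x *\<^sub>R f x)"
    using assms by (intro borel_integrable_compact) (auto intro: continuous_on_subset)
  moreover have "(\<lambda>x. indicator K x *\<^sub>R f x) = f"
    using assms(3) by (fastforce simp: indicator_def)
  ultimately show ?thesis
    by simp
qed

text \<open>
  Translation invariance makes the integral of every difference quotient of \<open>f\<close> vanish, and the
  difference quotients converge boundedly to the directional derivative.
\<close>

lemma integral_gradient_eq_0:
  fixes f :: "real^'n \<Rightarrow> real"
  assumes f: "has_C1_gradient f V" and K: "compact K" "\<And>x. x \<notin> K \<Longrightarrow> f x = 0"
  shows "(LINT x|lborel. V x \<bullet> e) = 0"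
proof -
  define q where "q n x = (f (x + inverse (real (Suc n)) *\<^sub>R e) - f x) / inverse (real (Suc n))" for n x
  have cont: "continuous_on UNIV f" "continuous_on UNIV V"
    using has_gradient_continuous[OF f] by auto
  have intf: "integrable lborel f"
    using cont K by (intro integrable_continuous_compact_support)
  obtain R where R: "K \<subseteq> cball 0 R"
    using compact_imp_bounded[OF K(1)] by (auto simp: bounded_iff subset_iff)
  have V0: "V x = 0" if "x \<notin> K" for x
    using has_gradient_zero_outside[OF f compact_imp_closed[OF K(1)] K(2) that] by simp
  obtain M where M: "\<And>x. norm (V x) \<le> M"
  proof -
    have "compact (V ` K)"
      using cont K by (intro compact_continuous_image) (auto intro: continuous_on_subset)
    then obtain M where "\<And>x. x \<in> K \<Longrightarrow> norm (V x) \<le> M" "M \<ge> 0"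
      by (metis bounded_pos compact_imp_bounded imageI less_imp_le)
    then have "norm (V x) \<le> M" for x
      by (cases "x \<in> K") (auto simp: V0)
    then show thesis
      using that by blast
  qed
  have lip: "norm (f y - f x) \<le> M * norm (y - x)" for x y
  proof (rule differentiable_bound[of UNIV])
    show "onorm (\<lambda>h. V z \<bullet> h) \<le> M" for z
    proof (rule onorm_bound)
      show "0 \<le> M"
        using M norm_ge_zero order_trans by blast
      show "norm (V z \<bullet> h) \<le> M * norm h" for h
        using Cauchy_Schwarz_ineq2[of "V z" h] M[of z] mult_right_mono norm_ge_zero order_trans
        by (metis real_norm_def)
    qed
  qed (use f in \<open>auto simp: has_C1_gradient_def\<close>)
  have shift: "integrable lborel (\<lambda>x. f (x + c))" "(LINT x|lborel. f (x + c)) = integral\<^sup>L lborel f" for c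
  proof -
    have "integrable (distr lborel borel ((+) c)) f"
      using intf by (simp add: lborel_distr_plus)
    then have "integrable lborel (\<lambda>x. f (c + x))"
      by (rule integrable_distr[rotated]) simp
    then show "integrable lborel (\<lambda>x. f (x + c))"
      by (simp add: add.commute)
    have "integral\<^sup>L (distr lborel borel ((+) c)) f = (LINT x|lborel. f (c + x))"
      by (rule integral_distr) (use intf in auto)
    then show "(LINT x|lborel. f (x + c)) = integral\<^sup>L lborel f"
      by (simp add: lborel_distr_plus add.commute)
  qed
  have q0: "integral\<^sup>L lborel (q n) = 0" for n
    unfolding q_def using intf shift by (simp del: of_nat_Suc)
  have "(\<lambda>n. integral\<^sup>L lborel (q n)) \<longlonglongrightarrow> (LINT x|lborel. V x \<bullet> e)"
  proof (rule integral_dominated_convergence)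
    show "integrable lborel (\<lambda>x. M * norm e * indicator (cball 0 (R + norm e)) x)"
      by (auto intro!: integrable_real_indicator emeasure_bounded_finite)
    show "AE x in lborel. (\<lambda>n. q n x) \<longlonglongrightarrow> V x \<bullet> e"
    proof (rule AE_I2)
      fix x
      have "((\<lambda>t. f (x + t *\<^sub>R e)) has_derivative (\<lambda>t. V x \<bullet> (t *\<^sub>R e))) (at 0)"
        by (rule has_derivative_compose[of "\<lambda>t. x + t *\<^sub>R e" "\<lambda>t. t *\<^sub>R e" 0 UNIV f, simplified])
           (use f in \<open>auto simp: has_C1_gradient_def intro!: derivative_eq_intros\<close>)
      then have "((\<lambda>t. f (x + t *\<^sub>R e)) has_real_derivative V x \<bullet> e) (at 0)"
        by (simp add: has_field_derivative_def mult_commute_abs)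
      then have "((\<lambda>t. (f (x + t *\<^sub>R e) - f x) / t) \<longlongrightarrow> V x \<bullet> e) (at 0)"
        by (simp add: DERIV_def)
      moreover have "filterlim (\<lambda>n. inverse (real (Suc n))) (at 0) sequentially"
        using LIMSEQ_inverse_real_of_nat by (auto simp: filterlim_at simp del: of_nat_Suc)
      ultimately show "(\<lambda>n. q n x) \<longlonglongrightarrow> V x \<bullet> e"
        unfolding q_def by (rule filterlim_compose)
    qed
    show "AE x in lborel. norm (q n x) \<le> M * norm e * indicator (cball 0 (R + norm e)) x" for n
    proof (rule AE_I2)
      fix x
      define s where "s = inverse (real (Suc n))"
      have s: "0 < s" "s \<le> 1"
        by (auto simp: s_def inverse_le_1_iff)
      have b: "norm (q n x) \<le> M * norm e"
        using lip[of "x + s *\<^sub>R e" x] s by (simp add: q_def s_def[symmetric] divide_le_eq mult.commute mult.left_commute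
          del: of_nat_Suc)
      show "norm (q n x) \<le> M * norm e * indicator (cball 0 (R + norm e)) x"
      proof (cases "x \<in> cball 0 (R + norm e)")
        case False
        have "s * norm e \<le> norm e"
          using s by (simp add: mult_left_le_one_le)
        then have "norm (x + s *\<^sub>R e) > R" "norm x > R"
          using False norm_triangle_ineq4[of "x + s *\<^sub>R e" "s *\<^sub>R e"] s
          by (auto simp: not_le) (smt (verit) norm_ge_zero)
        then have "x + s *\<^sub>R e \<notin> K" "x \<notin> K"
          using R by auto
        then show ?thesis
          using False K(2) by (simp add: q_def s_def)
      qed (use b in auto)
    qed
    show "(\<lambda>x. V x \<bullet> e) \<in> borel_measurable lborel"
      using cont(2) by (auto intro!: borel_measurable_continuous_onI continuous_intros)
    show "q n \<in> borel_measurable lborel" for n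
      unfolding q_def using cont(1)
      by (auto intro!: borel_measurable_continuous_onI continuous_intros continuous_on_compose2[OF cont(1)])
  qed
  then show ?thesis
    using q0 LIMSEQ_unique by (simp add: LIMSEQ_const_iff)
qed

lemma integral_lebesgue_on_compact_support:
  fixes f :: "real^'n \<Rightarrow> real"
  assumes "continuous_on UNIV f" "compact K" "\<And>x. x \<notin> K \<Longrightarrow> f x = 0" "K \<subseteq> S" "S \<in> sets lebesgue"
  shows "(LINT x|lebesgue_on S. f x) = (LINT x|lborel. f x)" "integrable (lebesgue_on S) f"
proof -
  have eq: "(\<lambda>x. indicator S x *\<^sub>R f x) = f"
    using assms(3,4) by (fastforce simp: indicator_def)
  have m: "f \<in> borel_measurable lborel"
    using assms(1) by (simp add: borel_measurable_continuous_onI)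
  show "(LINT x|lebesgue_on S. f x) = (LINT x|lborel. f x)"
    using assms(5) by (subst integral_restrict_space) (simp_all only: eq integral_completion[OF m], simp)
  show "integrable (lebesgue_on S) f"
    unfolding integrable_restrict_space[of S lebesgue, simplified, OF assms(5)]
    using integrable_continuous_compact_support[OF assms(1,2,3)] eq integrable_completion[OF m]
    by simp
qed

lemma integral_by_parts_test_function:
  fixes f :: "real^'n \<Rightarrow> real"
  assumes f: "has_C1_gradient f V" and \<psi>: "\<psi> \<in> test_functions S" and S: "S \<in> sets lebesgue"
  shows "(LINT x|lebesgue_on S. f x * partial i \<psi> x) = - (LINT x|lebesgue_on S. V x $ i * \<psi> x)"
proof -
  define P where "P = (\<lambda>z. \<chi> i. partial i \<psi> z)"
  have P: "has_C1_gradient \<psi> P"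
    unfolding P_def by (rule test_function_has_gradient[OF \<psi>])
  obtain K where K: "compact K" "K \<subseteq> S" "\<And>x. x \<notin> K \<Longrightarrow> \<psi> x = 0"
    using \<psi> by (auto simp: test_functions_def)
  have P0: "\<And>x. x \<notin> K \<Longrightarrow> P x = 0"
    using has_gradient_zero_outside[OF P compact_imp_closed[OF K(1)] K(3)] by blast
  have c: "continuous_on UNIV (\<lambda>x. f x * P x $ i)" "continuous_on UNIV (\<lambda>x. V x $ i * \<psi> x)"
    using has_gradient_continuous[OF f] has_gradient_continuous[OF P]
    by (auto intro!: continuous_intros)
  have "(LINT x|lborel. (f x *\<^sub>R P x + \<psi> x *\<^sub>R V x) \<bullet> axis i 1) = 0"
    by (rule integral_gradient_eq_0[OF has_gradient_mult[OF f P] K(1)]) (simp add: K)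
  then have "(LINT x|lborel. f x * P x $ i + V x $ i * \<psi> x) = 0"
    by (simp add: inner_axis mult.commute)
  moreover have "integrable lborel (\<lambda>x. f x * P x $ i)" "integrable lborel (\<lambda>x. V x $ i * \<psi> x)"
    using c K P0 by (auto intro!: integrable_continuous_compact_support)
  ultimately have "(LINT x|lborel. f x * P x $ i) = - (LINT x|lborel. V x $ i * \<psi> x)"
    by simp
  moreover have "(LINT x|lebesgue_on S. f x * P x $ i) = (LINT x|lborel. f x * P x $ i)"
    using c K P0 S by (intro integral_lebesgue_on_compact_support(1)) auto
  moreover have "(LINT x|lebesgue_on S. V x $ i * \<psi> x) = (LINT x|lborel. V x $ i * \<psi> x)"
    using c K S by (intro integral_lebesgue_on_compact_support(1)) auto
  ultimately show ?thesis
    by (simp add: P_def)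
qed

section \<open>Smooth bump functions\<close>

lemma partial_const: "partial i (\<lambda>z. c) = (\<lambda>z. 0)"
  by (simp add: fun_eq_iff partial_def)

lemma Ck_const: "Ck k (\<lambda>z. c)"
  by (induction k arbitrary: c) (simp_all add: partial_const)

lemma partial_add:
  assumes "f differentiable at z" "g differentiable at z"
  shows "partial i (\<lambda>x. f x + g x) z = partial i f z + partial i g z"
proof -
  have "((\<lambda>x. f x + g x) has_derivative
      (\<lambda>h. frechet_derivative f (at z) h + frechet_derivative g (at z) h)) (at z)"
    using assms by (intro has_derivative_add) (auto simp: frechet_derivative_works)
  from frechet_derivative_at[OF this, symmetric] show ?thesis
    by (simp only: partial_def)
qed

lemma partial_mult:
  assumes "f differentiable at z" "g differentiable at z"
  shows "partial i (\<lambda>x. f x * g x) z = f z * partial i g z + partial i f z * g z"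
proof -
  have "((\<lambda>x. f x * g x) has_derivative
      (\<lambda>h. f z * frechet_derivative g (at z) h + frechet_derivative f (at z) h * g z)) (at z)"
    using assms by (intro has_derivative_mult) (auto simp: frechet_derivative_works)
  from frechet_derivative_at[OF this, symmetric] show ?thesis
    by (simp only: partial_def)
qed

lemma Ck_add: "Ck k f \<Longrightarrow> Ck k g \<Longrightarrow> Ck k (\<lambda>x. f x + g x)"
proof (induction k arbitrary: f g)
  case 0
  then show ?case
    by (simp add: continuous_on_add)
next
  case (Suc k)
  have eq: "partial i (\<lambda>x. f x + g x) = (\<lambda>z. partial i f z + partial i g z)" for i
    using Suc.prems by (intro ext partial_add) (auto simp: differentiable_on_def)
  have "Ck k (partial i (\<lambda>x. f x + g x))" for i
    unfolding eq using Suc.prems by (intro Suc.IH) simp_all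
  moreover have "(\<lambda>x. f x + g x) differentiable_on UNIV"
    using Suc.prems by (intro differentiable_on_add) simp_all
  ultimately show ?case
    unfolding Ck.simps by (intro conjI allI)
qed

lemma Ck_mult: "Ck k f \<Longrightarrow> Ck k g \<Longrightarrow> Ck k (\<lambda>x. f x * g x)"
proof (induction k arbitrary: f g)
  case 0
  then show ?case
    by (simp add: continuous_on_mult)
next
  case (Suc k)
  have eq: "partial i (\<lambda>x. f x * g x) = (\<lambda>z. f z * partial i g z + partial i f z * g z)" for i
    using Suc.prems by (intro ext partial_mult) (auto simp: differentiable_on_def)
  have "Ck k f" "Ck k g"
    using Suc.prems Ck_Suc_imp_Ck by blast+
  have "Ck k (partial i (\<lambda>x. f x * g x))" for i
    unfolding eq using Suc.prems \<open>Ck k f\<close> \<open>Ck k g\<close> by (intro Ck_add Suc.IH) simp_all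
  moreover have "(\<lambda>x. f x * g x) differentiable_on UNIV"
    using Suc.prems by (intro differentiable_on_mult) simp_all
  ultimately show ?case
    unfolding Ck.simps by (intro conjI allI)
qed

lemma Ck_prod:
  assumes "finite A" "\<And>a. a \<in> A \<Longrightarrow> Ck k (f a)"
  shows "Ck k (\<lambda>x. \<Prod>a\<in>A. f a x)"
  using assms
proof (induction A rule: finite_induct)
  case empty
  show ?case
    by (simp only: prod.empty Ck_const)
next
  case (insert a A)
  then have "Ck k (\<lambda>x. f a x * (\<Prod>a\<in>A. f a x))"
    by (intro Ck_mult) simp_all
  then show ?case
    using insert.hyps by simp
qed

lemma has_gradient_coordinate:
  assumes "\<And>t. (g has_real_derivative g' t) (at t)" "continuous_on UNIV g'"
  shows "has_C1_gradient (\<lambda>z. g (z $ i)) (\<lambda>z. g' (z $ i) *\<^sub>R axis i 1)"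
proof -
  have "((\<lambda>z. g (z $ i)) has_derivative (\<lambda>h. (g' (z $ i) *\<^sub>R axis i 1) \<bullet> h)) (at z)" for z
  proof -
    have "((\<lambda>z. g (z $ i)) has_derivative (\<lambda>h. g' (z $ i) * h $ i)) (at z)"
      using assms(1) unfolding has_field_derivative_def
      by (intro has_derivative_compose[of "\<lambda>z. z $ i" "\<lambda>h. h $ i" z UNIV g "(*) (g' (z $ i))"])
         (auto intro!: bounded_linear_imp_has_derivative bounded_linear_vec_nth)
    then show ?thesis
      by (simp add: inner_axis')
  qed
  then show ?thesis
    by (auto simp: has_C1_gradient_def
        intro!: continuous_intros continuous_on_compose2[OF assms(2), of UNIV "\<lambda>z. z $ i"])
qed

text \<open>
  Smoothness of a function of one coordinate is certified by the whole sequence of its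
  one-dimensional derivatives; the induction moves along that sequence.
\<close>

lemma Ck_coordinate:
  assumes d: "\<And>m t. (g m has_real_derivative g (Suc m) t) (at t)"
  shows "Ck k (\<lambda>z. g m (z $ i))"
proof (induction k arbitrary: m)
  case 0
  have "continuous_on UNIV (g m)"
    using d DERIV_isCont continuous_at_imp_continuous_on by blast
  then show ?case
    by (auto intro!: continuous_on_compose2[of UNIV "g m"] continuous_intros)
next
  case (Suc k)
  have "continuous_on UNIV (g (Suc m))"
    using d DERIV_isCont continuous_at_imp_continuous_on by blast
  then have G: "has_C1_gradient (\<lambda>z. g m (z $ i)) (\<lambda>z. g (Suc m) (z $ i) *\<^sub>R axis i 1)"
    using d by (intro has_gradient_coordinate)
  then have "(\<lambda>z. g m (z $ i)) differentiable_on UNIV"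
    unfolding has_C1_gradient_def differentiable_on_def differentiable_def by blast
  moreover have "partial j (\<lambda>z. g m (z $ i)) = (\<lambda>z. g (Suc m) (z $ i) * (if j = i then 1 else 0))" for j
    using has_gradient_partial[OF G, of j] by (auto simp: fun_eq_iff axis_def)
  moreover have "Ck k (\<lambda>z. g (Suc m) (z $ i) * (if j = i then 1 else 0))" for j
    using Suc by (intro Ck_mult Ck_const)
  ultimately show ?case
    by simp
qed

text \<open>
  The classical function \<open>exp (- 1 / t)\<close>, extended by 0 to \<open>t \<le> 0\<close>, together with all its
  derivatives: polynomial factors in \<open>1 / t\<close> make the family closed under differentiation.
\<close>

definition flat :: "real poly \<Rightarrow> real \<Rightarrow> real" where
  "flat p t = (if t \<le> 0 then 0 else poly p (1 / t) * exp (- (1 / t)))"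

lemma flat_tendsto_0: "(flat p \<longlongrightarrow> 0) (at 0)"
proof -
  have "((\<lambda>x. poly p x * exp (- x)) \<longlongrightarrow> 0) at_top"
  proof -
    have "((\<lambda>x. \<Sum>i\<le>degree p. coeff p i * (x ^ i / exp x)) \<longlongrightarrow> (\<Sum>i\<le>degree p. coeff p i * 0)) at_top"
      by (intro tendsto_intros tendsto_power_div_exp_0)
    then show ?thesis
      by (simp add: poly_altdef sum_divide_distrib exp_minus field_simps)
  qed
  then have "((\<lambda>t. poly p (inverse t) * exp (- inverse t)) \<longlongrightarrow> 0) (at_right 0)"
    by (rule filterlim_compose[OF _ filterlim_inverse_at_top_right])
  then have "(flat p \<longlongrightarrow> 0) (at_right 0)"
    by (rule Lim_transform_eventually)
       (auto simp: flat_def eventually_at_filter inverse_eq_divide)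
  moreover have "(flat p \<longlongrightarrow> 0) (at_left 0)"
    by (rule Lim_transform_eventually[of "\<lambda>_. 0"])
       (auto simp: flat_def eventually_at_filter)
  ultimately show ?thesis
    by (simp add: filterlim_split_at)
qed

text \<open>
  At the origin the difference quotient of \<open>flat p\<close> is again a function of the family, with
  polynomial \<open>X p\<close>, so differentiability there reduces to the limit 0.
\<close>

lemma flat_DERIV:
  "(flat p has_real_derivative flat (monom 1 2 * (p - pderiv p)) t) (at t)"
proof -
  consider "t < 0" | "t > 0" | "t = 0"
    by linarith
  then show ?thesis
  proof cases
    case 1
    have "((\<lambda>t. 0) has_real_derivative 0) (at t)"
      by simp
    then have "(flat p has_real_derivative 0) (at t)"
      by (rule has_field_derivative_transform_within_open[of _ _ _ "{..<0}"])
         (use 1 in \<open>auto simp: flat_def\<close>)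
    then show ?thesis
      using 1 by (simp add: flat_def)
  next
    case 2
    have "((\<lambda>t. poly p (1 / t) * exp (- (1 / t))) has_real_derivative
        poly (pderiv p) (1 / t) * (- (1 / t\<^sup>2)) * exp (- (1 / t)) +
        poly p (1 / t) * (exp (- (1 / t)) * (1 / t\<^sup>2))) (at t)"
      using 2 by (auto intro!: derivative_eq_intros poly_DERIV simp: power2_eq_square)
    then have "(flat p has_real_derivative
        poly (pderiv p) (1 / t) * (- (1 / t\<^sup>2)) * exp (- (1 / t)) +
        poly p (1 / t) * (exp (- (1 / t)) * (1 / t\<^sup>2))) (at t)"
      by (rule has_field_derivative_transform_within_open[of _ _ _ "{0<..}"])
         (use 2 in \<open>auto simp: flat_def\<close>)
    moreover have "poly (pderiv p) (1 / t) * (- (1 / t\<^sup>2)) * exp (- (1 / t)) +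
        poly p (1 / t) * (exp (- (1 / t)) * (1 / t\<^sup>2)) = flat (monom 1 2 * (p - pderiv p)) t"
      using 2 by (simp add: flat_def poly_monom power_divide field_simps)
    ultimately show ?thesis
      by simp
  next
    case 3
    (* Dividing by h multiplies the polynomial by X. *)
    have "((\<lambda>h. (flat p (0 + h) - flat p 0) / h) \<longlongrightarrow> 0) (at 0)"
      by (rule Lim_transform_eventually[OF flat_tendsto_0[of "pCons 0 p"]])
         (auto simp: flat_def eventually_at_filter)
    then show ?thesis
      using 3 by (simp add: DERIV_def flat_def)
  qed
qed

text \<open>
  The scaling by \<open>Suc m\<close> makes the bumps converge to the indicator of the box, since
  \<open>exp (- 1 / (m t)) \<longlonglongrightarrow> 1\<close> for every \<open>t > 0\<close>.
\<close>

definition box_bump :: "nat \<Rightarrow> real^'n \<Rightarrow> real^'n \<Rightarrow> real^'n \<Rightarrow> real" where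
  "box_bump m a b z =
     (\<Prod>i\<in>UNIV. flat 1 (real (Suc m) * (z $ i - a $ i)) * flat 1 (real (Suc m) * (b $ i - z $ i)))"

lemma Ck_flat_affine: "Ck k (\<lambda>z. flat 1 (c * z $ i + d))"
proof -
  define g where "g m t = c ^ m * flat (((\<lambda>p. monom 1 2 * (p - pderiv p)) ^^ m) 1) (c * t + d)" for m t
  have "(g m has_real_derivative g (Suc m) t) (at t)" for m t
    unfolding g_def
    by (auto intro!: derivative_eq_intros DERIV_chain2[OF flat_DERIV] simp del: mult_Suc_right)
  then have "Ck k (\<lambda>z. g 0 (z $ i))"
    by (rule Ck_coordinate)
  then show ?thesis
    by (simp add: g_def)
qed

lemma box_bump_eq_0: "z \<notin> box a b \<Longrightarrow> box_bump m a b z = 0"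
proof -
  assume "z \<notin> box a b"
  then obtain i where "z $ i \<le> a $ i \<or> b $ i \<le> z $ i"
    by (auto simp: mem_box_cart not_less)
  then have "flat 1 (real (Suc m) * (z $ i - a $ i)) * flat 1 (real (Suc m) * (b $ i - z $ i)) = 0"
    by (auto simp: flat_def mult_le_0_iff simp del: of_nat_Suc)
  then show ?thesis
    unfolding box_bump_def by (intro prod_zero) auto
qed

lemma box_bump_pos: "z \<in> box a b \<Longrightarrow> 0 < box_bump m a b z"
  unfolding box_bump_def
  by (intro prod_pos ballI mult_pos_pos) (auto simp: mem_box_cart flat_def mult_le_0_iff not_le simp del: of_nat_Suc)

lemma box_bump_bounds: "0 \<le> box_bump m a b z" "box_bump m a b z \<le> 1"
proof -
  have "0 \<le> flat 1 t" "flat 1 t \<le> 1" for t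
    by (auto simp: flat_def)
  then show "0 \<le> box_bump m a b z" "box_bump m a b z \<le> 1"
    unfolding box_bump_def by (auto intro!: prod_nonneg prod_le_1 mult_le_one)
qed

lemma box_bump_test_function:
  assumes "cbox a b \<subseteq> S"
  shows "box_bump m a b \<in> test_functions S"
proof -
  have "Ck k (box_bump m a b)" for k
  proof -
    have "Ck k (\<lambda>z. flat 1 (real (Suc m) * z $ i + - (real (Suc m) * a $ i)) *
        flat 1 (- real (Suc m) * z $ i + real (Suc m) * b $ i))" for i
      by (intro Ck_mult Ck_flat_affine)
    then have "Ck k (\<lambda>z. \<Prod>i\<in>UNIV. flat 1 (real (Suc m) * z $ i + - (real (Suc m) * a $ i)) *
        flat 1 (- real (Suc m) * z $ i + real (Suc m) * b $ i))"
      by (intro Ck_prod) auto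
    moreover have "(\<lambda>z. \<Prod>i\<in>UNIV. flat 1 (real (Suc m) * z $ i + - (real (Suc m) * a $ i)) *
        flat 1 (- real (Suc m) * z $ i + real (Suc m) * b $ i)) = box_bump m a b"
      unfolding box_bump_def by (intro ext prod.cong) (auto simp: algebra_simps)
    ultimately show ?thesis
      by simp
  qed
  moreover have "\<forall>x. x \<notin> cbox a b \<longrightarrow> box_bump m a b x = 0"
    using box_bump_eq_0 box_subset_cbox by blast
  ultimately show ?thesis
    using assms compact_cbox[of a b] unfolding test_functions_def by blast
qed

lemma box_bump_tendsto: "(\<lambda>m. box_bump m a b z) \<longlonglongrightarrow> indicator (box a b) z"
proof (cases "z \<in> box a b")
  case True
  have lim: "(\<lambda>m. flat 1 (real (Suc m) * t)) \<longlonglongrightarrow> 1" if "t > 0" for t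
  proof -
    have "(\<lambda>m. exp (- (inverse (real (Suc m)) * (1 / t)))) \<longlonglongrightarrow> exp (- (0 * (1 / t)))"
      by (intro tendsto_intros LIMSEQ_inverse_real_of_nat)
    moreover have "flat 1 (real (Suc m) * t) = exp (- (inverse (real (Suc m)) * (1 / t)))" for m
    proof -
      have "0 < real (Suc m) * t"
        using that by simp
      then show ?thesis
        by (simp add: flat_def not_le field_simps del: of_nat_Suc)
    qed
    ultimately show ?thesis
      by simp
  qed
  have "(\<lambda>m. box_bump m a b z) \<longlonglongrightarrow> (\<Prod>i\<in>(UNIV::'a set). 1 * 1)"
    unfolding box_bump_def using True by (intro tendsto_intros lim) (auto simp: mem_box_cart)
  then show ?thesis
    using True by simp
qed (simp add: box_bump_eq_0)

section \<open>Uniqueness of weak derivatives\<close>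

text \<open>
  The empty intersection is handled separately: its representing box must have an empty closed
  box as well.
\<close>

lemma box_Int_subbox:
  fixes a b c d :: "real^'n"
  obtains a' b' where "box a b \<inter> box c d = box a' b'" "cbox a' b' \<subseteq> cbox c d"
proof (cases "box a b \<inter> box c d = {}")
  case True
  have "box a b \<inter> box c d = box (1::real^'n) 0" "cbox (1::real^'n) 0 \<subseteq> cbox c d"
    using True by (auto simp: mem_box_cart) (metis not_less_iff_gr_or_eq order_less_trans zero_less_one order_trans not_one_le_zero)+
  then show thesis
    using that by blast
next
  case False
  obtain a' b' where ab: "box a b \<inter> box c d = box a' b'"
    using box_Int_box by blast
  then have "closure (box a' b') \<subseteq> cbox c d"
    by (metis Int_lower2 box_subset_cbox closed_cbox closure_minimal order_trans)
  moreover have "closure (box a' b') = cbox a' b'"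
    using False ab by (simp add: closure_box)
  ultimately show thesis
    using that ab by blast
qed

lemma integral_box_eq_0:
  fixes f :: "real^'n \<Rightarrow> real"
  assumes S: "open S" and f: "locally_integrable S f"
    and zero: "\<And>\<psi>. \<psi> \<in> test_functions S \<Longrightarrow> (LINT x|lebesgue_on S. f x * \<psi> x) = 0"
    and ab: "cbox a b \<subseteq> S"
  shows "(LINT x|lebesgue. indicator (box a b) x * f x) = 0"
proof -
  have int: "integrable lebesgue (\<lambda>x. indicator (cbox a b) x * f x)"
    using f ab compact_cbox unfolding locally_integrable_def set_integrable_def by auto
  have "(\<lambda>m. LINT x|lebesgue. box_bump m a b x * (indicator (cbox a b) x * f x))
      \<longlonglongrightarrow> (LINT x|lebesgue. indicator (box a b) x * (indicator (cbox a b) x * f x))"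
  proof (rule integral_dominated_convergence)
    show "integrable lebesgue (\<lambda>x. norm (indicator (cbox a b) x * f x))"
      using int by (rule integrable_norm)
    have meas: "box_bump m a b \<in> borel_measurable lebesgue" for m
    proof -
      have "Ck 0 (box_bump m a b)"
        using box_bump_test_function[of a b UNIV m] unfolding test_functions_def by blast
      then show ?thesis
        by (auto intro!: measurable_completion borel_measurable_continuous_onI)
    qed
    show "(\<lambda>x. box_bump m a b x * (indicator (cbox a b) x * f x)) \<in> borel_measurable lebesgue" for m
      by (rule borel_measurable_times[OF meas borel_measurable_integrable[OF int]])
    show "(\<lambda>x. indicator (box a b) x * (indicator (cbox a b) x * f x)) \<in> borel_measurable lebesgue"
      by (rule borel_measurable_times[OF borel_measurable_indicator borel_measurable_integrable[OF int]]) simp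
    show "AE x in lebesgue. (\<lambda>m. box_bump m a b x * (indicator (cbox a b) x * f x))
        \<longlonglongrightarrow> indicator (box a b) x * (indicator (cbox a b) x * f x)"
      by (intro AE_I2 tendsto_intros box_bump_tendsto)
    show "AE x in lebesgue. norm (box_bump m a b x * (indicator (cbox a b) x * f x))
        \<le> norm (indicator (cbox a b) x * f x)" for m
      using box_bump_bounds[of m a b]
      by (intro AE_I2) (auto simp: abs_mult intro!: mult_left_le_one_le)
  qed
  moreover have "(LINT x|lebesgue. box_bump m a b x * (indicator (cbox a b) x * f x)) = 0" for m
  proof -
    have "(LINT x|lebesgue_on S. f x * box_bump m a b x) = 0"
      using zero[OF box_bump_test_function[OF ab]] .
    also have "(LINT x|lebesgue_on S. f x * box_bump m a b x) =
        (LINT x|lebesgue. indicator S x * (f x * box_bump m a b x))"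
      using S by (subst integral_restrict_space) auto
    also have "\<dots> = (LINT x|lebesgue. box_bump m a b x * (indicator (cbox a b) x * f x))"
    proof (rule Bochner_Integration.integral_cong[OF refl])
      fix x
      show "indicator S x * (f x * box_bump m a b x) = box_bump m a b x * (indicator (cbox a b) x * f x)"
      proof (cases "x \<in> box a b")
        case True
        then have "x \<in> cbox a b" "x \<in> S"
          using ab box_subset_cbox by auto
        then show ?thesis
          by simp
      qed (simp add: box_bump_eq_0)
    qed
    finally show ?thesis .
  qed
  ultimately have "(LINT x|lebesgue. indicator (box a b) x * (indicator (cbox a b) x * f x)) = 0"
    using LIMSEQ_unique by (simp add: LIMSEQ_const_iff)
  moreover have "indicator (box a b) x * (indicator (cbox a b) x * f x) = indicator (box a b) x * f x" for x
    using box_subset_cbox[of a b] by (auto simp: indicator_def)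
  ultimately show ?thesis
    by simp
qed

text \<open>
  The sets on which the integral of \<open>F\<close> vanishes form a Dynkin system containing the boxes,
  which are stable under intersection. Hence the integral vanishes over all Borel sets, and then
  over all Lebesgue sets.
\<close>

lemma AE_0_if_integral_boxes_0:
  fixes F :: "real^'n \<Rightarrow> real"
  assumes F: "integrable lebesgue F" and total: "(LINT x|lebesgue. F x) = 0"
    and boxes: "\<And>a b. (LINT x:box a b|lebesgue. F x) = 0"
  shows "AE x in lebesgue. F x = 0"
proof -
  have set: "set_integrable lebesgue A F" if "A \<in> sets lebesgue" for A
    using F that unfolding set_integrable_def by (rule integrable_mult_indicator[rotated])
  have borel: "(LINT x:A|lebesgue. F x) = 0" if "A \<in> sets borel" for A
  proof -
    define G where "G = range (\<lambda>(a, b). box a b :: (real^'n) set)"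
    have "Int_stable G"
      unfolding G_def by (auto simp: Int_stable_def) (metis box_Int_subbox rangeI case_prod_conv)
    moreover have "G \<subseteq> Pow UNIV"
      by simp
    moreover have "A \<in> sigma_sets UNIV G"
      using that unfolding G_def by (subst (asm) borel_eq_box) simp
    ultimately show ?thesis
    proof (induction A rule: sigma_sets_induct_disjoint)
      case (basic A)
      then show ?case
        using boxes by (auto simp: G_def)
    next
      case (compl A)
      then have A: "A \<in> sets lebesgue"
        unfolding G_def using borel_eq_box by (metis sets_completionI_sets sets_lborel sets_measure_of top_greatest Pow_UNIV)
      have "(LINT x:A \<union> (UNIV - A)|lebesgue. F x) =
          (LINT x:A|lebesgue. F x) + (LINT x:UNIV - A|lebesgue. F x)"
        using A by (intro set_integral_Un set) auto
      then show ?case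
        using compl total by (simp add: set_lebesgue_integral_def)
    next
      case (union A)
      then have A: "A i \<in> sets lebesgue" for i
        unfolding G_def using borel_eq_box
        by (metis range_subsetD sets_completionI_sets sets_lborel sets_measure_of top_greatest Pow_UNIV)
      have "(LINT x:(\<Union>i. A i)|lebesgue. F x) = (\<Sum>i. (LINT x:A i|lebesgue. F x))"
        using union A by (intro lebesgue_integral_countable_add set) (auto simp: disjoint_family_on_def)
      then show ?case
        using union by simp
    qed (auto simp: G_def set_lebesgue_integral_def)
  qed
  have "(LINT x:A|lebesgue. F x) = 0" if Al: "A \<in> sets lebesgue" for A
  proof -
    obtain B N N' where A: "A = B \<union> N" "N \<subseteq> N'" "N' \<in> null_sets lborel" "B \<in> sets lborel"
      using Al by (rule sets_completionE)
    have "AE x in lebesgue. x \<notin> N'"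
      using A(3) by (intro AE_completion AE_not_in)
    then have "AE x in lebesgue. indicator A x *\<^sub>R F x = indicator B x *\<^sub>R F x"
      by eventually_elim (use A in \<open>auto simp: indicator_def\<close>)
    then have "(LINT x:A|lebesgue. F x) = (LINT x:B|lebesgue. F x)"
      unfolding set_lebesgue_integral_def using F Al sets_completionI_sets[OF A(4)]
      by (intro integral_cong_AE borel_measurable_scaleR borel_measurable_indicator
          borel_measurable_integrable[OF F])
    then show ?thesis
      using borel A(4) by simp
  qed
  then show ?thesis
    using density_unique_real[OF F integrable_zero] by (simp add: set_lebesgue_integral_def)
qed

text \<open>
  Testing with bumps converging to the indicator of a box shows that all integrals over boxes
  inside \<open>S\<close> vanish; countably many closed boxes cover \<open>S\<close>.
\<close>

lemma fundamental_lemma: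
  fixes f :: "real^'n \<Rightarrow> real"
  assumes S: "open S" and f: "locally_integrable S f"
    and zero: "\<And>\<psi>. \<psi> \<in> test_functions S \<Longrightarrow> (LINT x|lebesgue_on S. f x * \<psi> x) = 0"
  shows "AE x in lebesgue_on S. f x = 0"
proof -
  obtain \<D> where D: "countable \<D>" "\<D> \<subseteq> Pow S" "\<And>X. X \<in> \<D> \<Longrightarrow> \<exists>a b. X = cbox a b" "\<Union>\<D> = S"
    using open_countable_Union_open_cbox[OF S] by metis
  have "AE x in lebesgue. x \<in> X \<longrightarrow> f x = 0" if XD: "X \<in> \<D>" for X
  proof -
    obtain c d where X: "X = cbox c d" "cbox c d \<subseteq> S"
      using D(2) D(3)[OF XD] XD by auto
    define F where "F x = indicator (box c d) x * f x" for x
    have int: "integrable lebesgue (\<lambda>x. indicator (cbox c d) x * f x)"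
      using f X(2) compact_cbox unfolding locally_integrable_def set_integrable_def by auto
    have "integrable lebesgue (\<lambda>x. indicator (box c d) x *\<^sub>R (indicator (cbox c d) x * f x))"
      by (intro integrable_mult_indicator int) auto
    moreover have "(\<lambda>x. indicator (box c d) x *\<^sub>R (indicator (cbox c d) x * f x)) = F"
      using box_subset_cbox[of c d] by (auto simp: indicator_def F_def fun_eq_iff)
    ultimately have F: "integrable lebesgue F"
      by simp
    have "AE x in lebesgue. F x = 0"
    proof (rule AE_0_if_integral_boxes_0[OF F])
      show "(LINT x|lebesgue. F x) = 0"
        unfolding F_def by (rule integral_box_eq_0[OF S f zero X(2)])
      show "(LINT x:box a b|lebesgue. F x) = 0" for a b
      proof -
        obtain a' b' where ab: "box a b \<inter> box c d = box a' b'" "cbox a' b' \<subseteq> cbox c d"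
          by (rule box_Int_subbox)
        have "(LINT x|lebesgue. indicator (box a' b') x * f x) = 0"
          using integral_box_eq_0[OF S f zero, of a' b'] ab(2) X(2) by blast
        then show ?thesis
          unfolding set_lebesgue_integral_def F_def ab(1)[symmetric]
          by (simp add: indicator_inter_arith mult.assoc)
      qed
    qed
    moreover have "AE x in lebesgue. x \<notin> cbox c d - box c d"
      using negligible_frontier_interval[of c d] unfolding negligible_iff_null_sets by (rule AE_not_in)
    ultimately show ?thesis
      by eventually_elim (auto simp: X(1) F_def indicator_def split: if_splits)
  qed
  then have "AE x in lebesgue. \<forall>X\<in>\<D>. x \<in> X \<longrightarrow> f x = 0"
    by (rule AE_ball_countable'[OF _ D(1)])
  then have "AE x in lebesgue. x \<in> S \<longrightarrow> f x = 0"
    by eventually_elim (use D(4) in blast)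
  then show ?thesis
    using S by (simp add: AE_restrict_space_iff)
qed

lemma locally_integrable_component:
  fixes V :: "real^'n \<Rightarrow> 'b::euclidean_space^'m"
  assumes "locally_integrable S V"
  shows "locally_integrable S (\<lambda>x. V x $ i)"
  using assms absolutely_integrable_linear[OF _ bounded_linear_vec_nth, where f=V]
  unfolding locally_integrable_def by (simp add: o_def)

lemma locally_integrable_diff:
  assumes "locally_integrable S f" "locally_integrable S g"
  shows "locally_integrable S (\<lambda>x. f x - g x)"
  using assms unfolding locally_integrable_def by (auto intro: set_integral_diff(1))

lemma integrable_mult_test_function:
  fixes f :: "real^'n \<Rightarrow> real"
  assumes S: "open S" and f: "locally_integrable S f" and \<psi>: "\<psi> \<in> test_functions S"
  shows "integrable (lebesgue_on S) (\<lambda>x. f x * \<psi> x)"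
proof -
  obtain K where K: "compact K" "K \<subseteq> S" "\<And>x. x \<notin> K \<Longrightarrow> \<psi> x = 0"
    using \<psi> by (auto simp: test_functions_def)
  have c: "continuous_on UNIV \<psi>"
    using \<psi> unfolding test_functions_def by (metis (mono_tags, lifting) Ck.simps(1) mem_Collect_eq)
  have "compact (\<psi> ` K)"
    using c K by (intro compact_continuous_image) (auto intro: continuous_on_subset)
  then obtain B where "\<And>x. x \<in> K \<Longrightarrow> \<bar>\<psi> x\<bar> \<le> B"
    by (metis bounded_iff compact_imp_bounded imageI real_norm_def)
  then have B: "\<bar>\<psi> x\<bar> \<le> \<bar>B\<bar>" for x
    using K(3) by (cases "x \<in> K") force+
  have int: "integrable lebesgue (\<lambda>x. indicator K x * f x)"
    using f K unfolding locally_integrable_def set_integrable_def by auto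
  have "integrable lebesgue (\<lambda>x. indicator K x * f x * \<psi> x)"
  proof (rule Bochner_Integration.integrable_bound)
    show "integrable lebesgue (\<lambda>x. \<bar>B\<bar> * (indicator K x * f x))"
      using int by simp
    have \<psi>m: "\<psi> \<in> borel_measurable lebesgue"
      using c by (auto intro!: measurable_completion borel_measurable_continuous_onI)
    show "(\<lambda>x. indicator K x * f x * \<psi> x) \<in> borel_measurable lebesgue"
      by (rule borel_measurable_times[OF borel_measurable_integrable[OF int] \<psi>m])
    show "AE x in lebesgue. norm (indicator K x * f x * \<psi> x) \<le> norm (\<bar>B\<bar> * (indicator K x * f x))"
      using B by (intro AE_I2) (auto simp: abs_mult mult.commute[of "\<bar>B\<bar>"] intro!: mult_left_mono)
  qed
  moreover have "(\<lambda>x. indicator K x * f x * \<psi> x) = (\<lambda>x. indicator S x *\<^sub>R (f x * \<psi> x))"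
    using K by (auto simp: indicator_def fun_eq_iff)
  ultimately show ?thesis
    using S by (simp add: integrable_restrict_space)
qed

lemma AE_eq_if_test_integrals_eq:
  fixes f g :: "real^'n \<Rightarrow> real"
  assumes S: "open S" and f: "locally_integrable S f" and g: "locally_integrable S g"
    and eq: "\<And>\<psi>. \<psi> \<in> test_functions S \<Longrightarrow>
      (LINT x|lebesgue_on S. f x * \<psi> x) = (LINT x|lebesgue_on S. g x * \<psi> x)"
  shows "AE x in lebesgue_on S. f x = g x"
proof -
  have "AE x in lebesgue_on S. f x - g x = 0"
  proof (rule fundamental_lemma[OF S locally_integrable_diff[OF f g]])
    fix \<psi> assume \<psi>: "\<psi> \<in> test_functions S"
    show "(LINT x|lebesgue_on S. (f x - g x) * \<psi> x) = 0"
      using eq[OF \<psi>] integrable_mult_test_function[OF S f \<psi>] integrable_mult_test_function[OF S g \<psi>]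
      by (simp add: left_diff_distrib)
  qed
  then show ?thesis
    by simp
qed

lemma AE_vec_eq:
  fixes V W :: "'a \<Rightarrow> 'b^'n"
  assumes "\<And>i. AE x in M. V x $ i = W x $ i"
  shows "AE x in M. V x = W x"
  using assms by (simp add: vec_eq_iff AE_all_countable)

lemma weak_gradient_unique:
  assumes S: "open S" and V: "has_weak_gradient S u V" and W: "has_weak_gradient S u W"
  shows "AE x in lebesgue_on S. V x = W x"
  using V W unfolding has_weak_gradient_def
  by (intro AE_vec_eq AE_eq_if_test_integrals_eq[OF S] locally_integrable_component) auto

lemma weak_hessian_unique:
  assumes S: "open S" and H: "has_weak_hessian S u H" and G: "has_weak_hessian S u G"
  shows "AE x in lebesgue_on S. H x = G x"
  using H G unfolding has_weak_hessian_def
  by (intro AE_vec_eq AE_eq_if_test_integrals_eq[OF S] locally_integrable_component) auto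

text \<open>
  By uniqueness, quantities such as the Dirichlet energy may be computed with any weak
  gradient.
\<close>

lemma weak_gradient_AE:
  assumes "open S" "has_weak_gradient S u V"
  shows "AE x in lebesgue_on S. weak_gradient S u x = V x"
  using assms weak_gradient_unique someI_ex[of "has_weak_gradient S u"]
  unfolding weak_gradient_def by blast

lemma weak_hessian_AE:
  assumes "open S" "has_weak_hessian S u H"
  shows "AE x in lebesgue_on S. weak_hessian S u x = H x"
  using assms weak_hessian_unique someI_ex[of "has_weak_hessian S u"]
  unfolding weak_hessian_def by blast

section \<open>Superharmonic functions solve their own obstacle problem\<close>

text \<open>
  Measurability of \<open>f\<close> comes from the completeness of Lebesgue measure. It is what allows the
  arbitrarily chosen representative \<open>weak_gradient S u\<close> to be replaced under the integral.
\<close>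

lemma integral_cong_AE_lebesgue_on:
  fixes f g :: "real^'n \<Rightarrow> real"
  assumes S: "open S" and eq: "AE x in lebesgue_on S. f x = g x"
    and g: "g \<in> borel_measurable (lebesgue_on S)"
  shows "(LINT x|lebesgue_on S. f x) = (LINT x|lebesgue_on S. g x)"
proof -
  have "AE x in lebesgue. indicator S x *\<^sub>R g x = indicator S x *\<^sub>R f x"
    using eq S by (simp add: AE_restrict_space_iff) (auto elim!: eventually_mono simp: indicator_def)
  moreover have "(\<lambda>x. indicator S x *\<^sub>R g x) \<in> borel_measurable lebesgue"
    using g S by (simp add: borel_measurable_restrict_space_iff)
  ultimately have "(\<lambda>x. indicator S x *\<^sub>R f x) \<in> borel_measurable lebesgue"
    using borel_measurable_AE[of "\<lambda>x. indicator S x *\<^sub>R g x" "\<lambda>x. indicator S x *\<^sub>R f x"] by blast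
  then have "f \<in> borel_measurable (lebesgue_on S)"
    using S by (simp add: borel_measurable_restrict_space_iff)
  then show ?thesis
    using eq g by (intro integral_cong_AE)
qed

lemma finite_measure_lebesgue_on_bounded:
  assumes "open S" "bounded S"
  shows "finite_measure (lebesgue_on S)"
  using emeasure_bounded_finite[OF assms(2)] assms(1)
  by (intro finite_measureI) (simp add: emeasure_restrict_space space_restrict_space)

lemma continuous_measurable_lebesgue_on:
  fixes f :: "real^'n \<Rightarrow> 'b::euclidean_space"
  assumes "continuous_on UNIV f"
  shows "f \<in> borel_measurable (lebesgue_on S)"
proof -
  have "f \<in> borel_measurable lebesgue"
    using assms by (auto intro!: measurable_completion borel_measurable_continuous_onI)
  then show ?thesis
    by (rule measurable_restrict_space1)
qed

lemma bounded_measurable_integrable: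
  fixes f :: "real^'n \<Rightarrow> 'b::euclidean_space"
  assumes S: "open S" "bounded S" and f: "f \<in> borel_measurable (lebesgue_on S)"
    and B: "\<And>x. x \<in> S \<Longrightarrow> norm (f x) \<le> B"
  shows "integrable (lebesgue_on S) f"
proof -
  interpret finite_measure "lebesgue_on S"
    using S by (rule finite_measure_lebesgue_on_bounded)
  show ?thesis
    using B f by (intro integrable_const_bound[of f B]) (auto intro!: AE_I2)
qed

lemma continuous_bounded_on:
  fixes f :: "real^'n \<Rightarrow> 'b::euclidean_space"
  assumes "continuous_on UNIV f" "bounded S"
  obtains B where "B \<ge> 0" "\<And>x. x \<in> S \<Longrightarrow> norm (f x) \<le> B"
proof -
  have "compact (f ` closure S)"
    using assms by (intro compact_continuous_image) (auto intro: continuous_on_subset)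
  then obtain B where "B > 0" "\<And>x. x \<in> closure S \<Longrightarrow> norm (f x) \<le> B"
    by (metis bounded_pos compact_imp_bounded imageI)
  then show thesis
    using that[of B] closure_subset by force
qed

lemma continuous_integrable_lebesgue_on:
  fixes f :: "real^'n \<Rightarrow> 'b::euclidean_space"
  assumes "open S" "bounded S" "continuous_on UNIV f"
  shows "integrable (lebesgue_on S) f"
  using assms continuous_bounded_on[OF assms(3,2)] continuous_measurable_lebesgue_on[OF assms(3)]
  by (metis bounded_measurable_integrable)

lemma bounded_Lp_space:
  fixes f :: "real^'n \<Rightarrow> 'b::euclidean_space"
  assumes S: "open S" "bounded S" and f: "f \<in> borel_measurable (lebesgue_on S)"
    and B: "\<And>x. x \<in> S \<Longrightarrow> norm (f x) \<le> B" and p: "p \<ge> 0"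
  shows "f \<in> Lp_space p S"
proof -
  have "integrable (lebesgue_on S) (\<lambda>x. norm (f x) powr p)"
    using f B p by (intro bounded_measurable_integrable[OF S, of _ "B powr p"])
      (auto intro!: powr_mono2)
  then show ?thesis
    using f by (simp add: Lp_space_def)
qed

lemma continuous_Lp_space:
  fixes f :: "real^'n \<Rightarrow> 'b::euclidean_space"
  assumes S: "open S" "bounded S" and f: "continuous_on UNIV f" and p: "p \<ge> 0"
  shows "f \<in> Lp_space p S"
  using continuous_bounded_on[OF f S(2)] bounded_Lp_space[OF S continuous_measurable_lebesgue_on[OF f] _ p]
  by metis

lemma integrable_imp_locally_integrable:
  fixes f :: "real^'n \<Rightarrow> 'b::euclidean_space"
  assumes S: "open S" and f: "integrable (lebesgue_on S) f"
  shows "locally_integrable S f"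
  unfolding locally_integrable_def
proof safe
  fix K assume "compact K" "K \<subseteq> S"
  moreover have "set_integrable lebesgue S f"
    using S f by (simp add: set_integrable_def integrable_restrict_space)
  ultimately show "f absolutely_integrable_on K"
    by (metis set_integrable_subset lmeasurable_compact fmeasurableD)
qed

lemma has_gradient_imp_weak:
  assumes S: "open S" "bounded S" and f: "has_C1_gradient f V"
  shows "has_weak_gradient S f V"
  unfolding has_weak_gradient_def
proof (intro conjI ballI allI)
  show "locally_integrable S f" "locally_integrable S V"
    using S has_gradient_continuous[OF f]
    by (auto intro!: integrable_imp_locally_integrable continuous_integrable_lebesgue_on)
  show "(LINT x|lebesgue_on S. f x * partial i \<psi> x) = - (LINT x|lebesgue_on S. V x $ i * \<psi> x)"
    if "\<psi> \<in> test_functions S" for \<psi> i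
    using S by (intro integral_by_parts_test_function[OF f that]) auto
qed

lemma has_weak_gradient_diff:
  assumes S: "open S" and u: "has_weak_gradient S u U" and v: "has_weak_gradient S v V"
  shows "has_weak_gradient S (\<lambda>x. u x - v x) (\<lambda>x. U x - V x)"
proof -
  have l: "locally_integrable S u" "locally_integrable S U" "locally_integrable S v" "locally_integrable S V"
    using u v by (auto simp: has_weak_gradient_def)
  have "(LINT x|lebesgue_on S. (u x - v x) * partial i \<psi> x) = - (LINT x|lebesgue_on S. (U x - V x) $ i * \<psi> x)"
    if \<psi>: "\<psi> \<in> test_functions S" for \<psi> i
  proof -
    have "(LINT x|lebesgue_on S. (u x - v x) * partial i \<psi> x) =
        (LINT x|lebesgue_on S. u x * partial i \<psi> x) - (LINT x|lebesgue_on S. v x * partial i \<psi> x)"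
      using integrable_mult_test_function[OF S _ partial_test_function[OF \<psi>]] l
      by (simp add: left_diff_distrib)
    also have "\<dots> = - ((LINT x|lebesgue_on S. U x $ i * \<psi> x) - (LINT x|lebesgue_on S. V x $ i * \<psi> x))"
      using u v \<psi> by (simp add: has_weak_gradient_def)
    also have "\<dots> = - (LINT x|lebesgue_on S. (U x - V x) $ i * \<psi> x)"
      using integrable_mult_test_function[OF S locally_integrable_component[OF l(2)] \<psi>]
        integrable_mult_test_function[OF S locally_integrable_component[OF l(4)] \<psi>]
      by (simp add: left_diff_distrib)
    finally show ?thesis .
  qed
  then show ?thesis
    using l by (simp add: has_weak_gradient_def locally_integrable_diff)
qed

lemma Lp_space_2_iff:
  "f \<in> Lp_space 2 S \<longleftrightarrow>
     f \<in> borel_measurable (lebesgue_on S) \<and> integrable (lebesgue_on S) (\<lambda>x. (norm (f x))\<^sup>2)"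
  by (simp add: Lp_space_def)

lemma norm_diff_square_le: "(norm (a - b))\<^sup>2 \<le> 2 * (norm a)\<^sup>2 + 2 * (norm (b :: 'a::real_inner))\<^sup>2"
proof -
  have "(norm (a - b))\<^sup>2 \<le> (norm a + norm b)\<^sup>2"
    by (intro power_mono norm_triangle_ineq4) simp
  also have "\<dots> \<le> 2 * (norm a)\<^sup>2 + 2 * (norm b)\<^sup>2"
    using zero_le_power2[of "norm a - norm b"] by (simp add: power2_eq_square algebra_simps)
  finally show ?thesis .
qed

lemma Lp_space_2_diff:
  fixes f g :: "real^'n \<Rightarrow> 'b::euclidean_space"
  assumes "f \<in> Lp_space 2 S" "g \<in> Lp_space 2 S"
  shows "(\<lambda>x. f x - g x) \<in> Lp_space 2 S"
proof -
  have "integrable (lebesgue_on S) (\<lambda>x. (norm (f x - g x))\<^sup>2)"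
    by (rule Bochner_Integration.integrable_bound[of _ "\<lambda>x. 2 * (norm (f x))\<^sup>2 + 2 * (norm (g x))\<^sup>2"])
       (use assms norm_diff_square_le in \<open>auto simp: Lp_space_2_iff intro!: AE_I2\<close>)
  moreover have "(\<lambda>x. f x - g x) \<in> borel_measurable (lebesgue_on S)"
    using assms by (intro borel_measurable_diff) (auto simp: Lp_space_2_iff)
  ultimately show ?thesis
    by (simp add: Lp_space_2_iff)
qed

lemma Lp_space_2_inner_integrable:
  fixes f g :: "real^'n \<Rightarrow> 'b::euclidean_space"
  assumes "f \<in> Lp_space 2 S" "g \<in> Lp_space 2 S"
  shows "integrable (lebesgue_on S) (\<lambda>x. f x \<bullet> g x)"
proof (rule Bochner_Integration.integrable_bound[of _ "\<lambda>x. (norm (f x))\<^sup>2 + (norm (g x))\<^sup>2"])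
  have "\<bar>a \<bullet> b\<bar> \<le> (norm a)\<^sup>2 + (norm b)\<^sup>2" for a b :: 'b
  proof -
    have "2 * (norm a * norm b) \<le> (norm a)\<^sup>2 + (norm b)\<^sup>2"
      using zero_le_power2[of "norm a - norm b"] by (simp add: power2_eq_square algebra_simps)
    moreover have "0 \<le> norm a * norm b"
      by simp
    ultimately show ?thesis
      using Cauchy_Schwarz_ineq2[of a b] by linarith
  qed
  then show "AE x in lebesgue_on S. norm (f x \<bullet> g x) \<le> norm ((norm (f x))\<^sup>2 + (norm (g x))\<^sup>2)"
    by (intro AE_I2) simp
qed (use assms in \<open>auto simp: Lp_space_2_iff\<close>)

text \<open>
  Instead of the Cauchy-Schwarz inequality, the pointwise bound \<open>\<bar>y\<bar> \<le> t + \<bar>y\<bar>\<^sup>2 / t\<close> is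
  integrated with \<open>t\<close> slightly larger than the square root of the integral of the square.
\<close>

lemma (in finite_measure) integral_norm_tendsto_0_if_square:
  fixes G :: "nat \<Rightarrow> 'a \<Rightarrow> 'b::euclidean_space"
  assumes meas: "\<And>k. G k \<in> borel_measurable M"
    and int: "\<And>k. integrable M (\<lambda>x. (norm (G k x))\<^sup>2)"
    and lim: "(\<lambda>k. LINT x|M. (norm (G k x))\<^sup>2) \<longlonglongrightarrow> 0"
  shows "integrable M (\<lambda>x. norm (G k x))" "(\<lambda>k. LINT x|M. norm (G k x)) \<longlonglongrightarrow> 0"
proof -
  have bound: "norm a \<le> t + (norm a)\<^sup>2 / t" if "t > 0" for a :: 'b and t :: real
  proof (cases "norm a \<le> t")
    case False
    then have "norm a * t \<le> (norm a)\<^sup>2"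
      by (simp add: power2_eq_square mult_left_mono)
    then have "norm a \<le> (norm a)\<^sup>2 / t"
      using that by (simp add: pos_le_divide_eq)
    then show ?thesis
      using that by simp
  qed (use that in \<open>simp add: add_increasing2\<close>)
  show int1: "integrable M (\<lambda>x. norm (G k x))" for k
    by (rule Bochner_Integration.integrable_bound[of _ "\<lambda>x. 1 + (norm (G k x))\<^sup>2"])
       (use meas int bound[of 1] in \<open>auto intro!: AE_I2\<close>)
  define I where "I k = (LINT x|M. (norm (G k x))\<^sup>2)" for k
  (* The second summand keeps t positive when the integral is 0. *)
  define t where "t k = sqrt (I k) + inverse (real (Suc k))" for k
  have I0: "0 \<le> I k" for k
    by (simp add: I_def)
  have t0: "0 < t k" for k
    using I0[of k] by (simp add: t_def add_nonneg_pos)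
  have "(LINT x|M. norm (G k x)) \<le> t k * measure M (space M) + sqrt (I k)" for k
  proof -
    have "(LINT x|M. norm (G k x)) \<le> (LINT x|M. t k + (norm (G k x))\<^sup>2 / t k)"
      using int1 int bound[OF t0[of k]] by (intro integral_mono) auto
    also have "\<dots> = t k * measure M (space M) + I k / t k"
      using int by (simp add: I_def mult.commute)
    also have "I k / t k \<le> sqrt (I k)"
    proof -
      have "I k = sqrt (I k) * sqrt (I k)"
        using I0 by simp
      also have "\<dots> \<le> sqrt (I k) * t k"
        using I0 by (intro mult_left_mono) (auto simp: t_def)
      finally show ?thesis
        using t0[of k] by (simp add: divide_le_eq)
    qed
    finally show ?thesis
      by simp
  qed
  then have upper: "\<forall>\<^sub>F k in sequentially.
      (LINT x|M. norm (G k x)) \<le> t k * measure M (space M) + sqrt (I k)"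
    by (rule always_eventually[OF allI])
  have "(\<lambda>k. t k * measure M (space M) + sqrt (I k)) \<longlonglongrightarrow> (sqrt 0 + 0) * measure M (space M) + sqrt 0"
    unfolding t_def using lim I_def by (intro tendsto_intros LIMSEQ_inverse_real_of_nat) simp_all
  then have upper_lim: "(\<lambda>k. t k * measure M (space M) + sqrt (I k)) \<longlonglongrightarrow> 0"
    by simp
  show "(\<lambda>k. LINT x|M. norm (G k x)) \<longlonglongrightarrow> 0"
    by (rule tendsto_sandwich[OF _ upper tendsto_const upper_lim]) simp
qed

lemma integral_gradient_inner_test_function:
  fixes f :: "real^'n \<Rightarrow> real"
  assumes S: "open S" "bounded S"
    and U: "\<And>i. has_C1_gradient (\<lambda>z. U z $ i) (\<lambda>z. H z $ i)"
    and \<psi>: "\<psi> \<in> test_functions S"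
  shows "(LINT x|lebesgue_on S. U x \<bullet> (\<chi> i. partial i \<psi> x)) =
    - (LINT x|lebesgue_on S. (\<Sum>i\<in>UNIV. H x $ i $ i) * \<psi> x)"
proof -
  have c: "continuous_on UNIV \<psi>" "continuous_on UNIV (\<lambda>x. partial i \<psi> x)" for i
    using has_gradient_continuous(1)[OF test_function_has_gradient] \<psi> partial_test_function by blast+
  have cU: "continuous_on UNIV (\<lambda>x. U x $ i)" "continuous_on UNIV (\<lambda>x. H x $ i $ i)" for i
    using has_gradient_continuous(1)[OF U] has_gradient_component_continuous[OF U] by auto
  have "(LINT x|lebesgue_on S. U x \<bullet> (\<chi> i. partial i \<psi> x)) =
      (\<Sum>i\<in>UNIV. LINT x|lebesgue_on S. U x $ i * partial i \<psi> x)"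
    using S c cU unfolding inner_vec_def
    by (subst Bochner_Integration.integral_sum[symmetric])
       (auto intro!: continuous_integrable_lebesgue_on continuous_on_mult)
  also have "\<dots> = (\<Sum>i\<in>UNIV. - (LINT x|lebesgue_on S. H x $ i $ i * \<psi> x))"
    using S by (intro sum.cong refl integral_by_parts_test_function[OF U \<psi>]) auto
  also have "\<dots> = - (LINT x|lebesgue_on S. (\<Sum>i\<in>UNIV. H x $ i $ i) * \<psi> x)"
    unfolding sum_distrib_right using S c cU
    by (subst Bochner_Integration.integral_sum)
       (auto intro!: continuous_integrable_lebesgue_on continuous_on_mult simp: sum_negf)
  finally show ?thesis .
qed

text \<open>
  The \<open>W\<^sup>1\<^sup>,\<^sup>2\<close> approximation by test functions enters below only through integrals
  against bounded functions, so convergence of values and gradients in \<open>L\<^sup>1\<close> is what is extracted.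
\<close>

lemma W1_0_approximation:
  assumes S: "open S" "bounded S" and v: "v \<in> W1_0 2 S"
    and V: "has_weak_gradient S v V" "V \<in> Lp_space 2 S"
  obtains \<psi> where "\<And>k. \<psi> k \<in> test_functions S"
    "\<And>k. integrable (lebesgue_on S) (\<lambda>x. \<bar>v x - \<psi> k x\<bar>)"
    "\<And>k. integrable (lebesgue_on S) (\<lambda>x. norm (V x - (\<chi> i. partial i (\<psi> k) x)))"
    "(\<lambda>k. LINT x|lebesgue_on S. \<bar>v x - \<psi> k x\<bar>) \<longlonglongrightarrow> 0"
    "(\<lambda>k. LINT x|lebesgue_on S. norm (V x - (\<chi> i. partial i (\<psi> k) x))) \<longlonglongrightarrow> 0"
proof -
  interpret finite_measure "lebesgue_on S"
    using S by (rule finite_measure_lebesgue_on_bounded)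
  obtain \<psi> where \<psi>: "\<And>k. \<psi> k \<in> test_functions S"
    and lim: "(\<lambda>k. W1_norm 2 S (\<lambda>x. v x - \<psi> k x)) \<longlonglongrightarrow> 0"
    using v by (auto simp: W1_0_def)
  define P where "P k = (\<lambda>x. \<chi> i. partial i (\<psi> k) x)" for k
  have P: "has_C1_gradient (\<psi> k) (P k)" for k
    unfolding P_def by (rule test_function_has_gradient[OF \<psi>])
  have vL: "v \<in> Lp_space 2 S"
    using v by (auto simp: W1_0_def W1_def)
  have dL: "(\<lambda>x. v x - \<psi> k x) \<in> Lp_space 2 S" "(\<lambda>x. V x - P k x) \<in> Lp_space 2 S" for k
    by (intro Lp_space_2_diff continuous_Lp_space[OF S] has_gradient_continuous[OF P] vL V(2), simp)+
  have grad: "AE x in lebesgue_on S. weak_gradient S (\<lambda>x. v x - \<psi> k x) x = V x - P k x" for k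
    using S V(1) has_gradient_imp_weak[OF S P]
    by (intro weak_gradient_AE has_weak_gradient_diff)
  define A where "A k = (LINT x|lebesgue_on S. (norm (v x - \<psi> k x))\<^sup>2)" for k
  define B where "B k = (LINT x|lebesgue_on S. (norm (V x - P k x))\<^sup>2)" for k
  have AB0: "0 \<le> A k" "0 \<le> B k" for k
    by (auto simp: A_def B_def)
  have "W1_norm 2 S (\<lambda>x. v x - \<psi> k x) = sqrt (A k + B k)" for k
  proof -
    have "(LINT x|lebesgue_on S. norm (weak_gradient S (\<lambda>x. v x - \<psi> k x) x) powr 2) =
        (LINT x|lebesgue_on S. norm (V x - P k x) powr 2)"
    proof -
      have eq: "AE x in lebesgue_on S. norm (weak_gradient S (\<lambda>x. v x - \<psi> k x) x) powr 2 =
          norm (V x - P k x) powr 2"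
        using grad[of k] by eventually_elim simp
      have m: "(\<lambda>x. norm (V x - P k x) powr 2) \<in> borel_measurable (lebesgue_on S)"
        using dL(2)[of k] by (auto simp: Lp_space_def)
      show ?thesis
        by (rule integral_cong_AE_lebesgue_on[OF S(1) eq m])
    qed
    then show ?thesis
      using AB0[of k] by (simp add: W1_norm_def A_def B_def powr_half_sqrt)
  qed
  then have "(\<lambda>k. (sqrt (A k + B k))\<^sup>2) \<longlonglongrightarrow> 0\<^sup>2"
    using lim by (intro tendsto_power) simp
  then have AB: "(\<lambda>k. A k + B k) \<longlonglongrightarrow> 0"
    using AB0 by simp
  have "A \<longlonglongrightarrow> 0" "B \<longlonglongrightarrow> 0"
    using AB0 by (auto intro!: tendsto_sandwich[OF _ _ tendsto_const AB] always_eventually)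
  then have lims: "(\<lambda>k. LINT x|lebesgue_on S. (norm (v x - \<psi> k x))\<^sup>2) \<longlonglongrightarrow> 0"
      "(\<lambda>k. LINT x|lebesgue_on S. (norm (V x - P k x))\<^sup>2) \<longlonglongrightarrow> 0"
    by (simp_all add: A_def[abs_def] B_def[abs_def])
  have meas: "(\<lambda>x. v x - \<psi> k x) \<in> borel_measurable (lebesgue_on S)"
    "integrable (lebesgue_on S) (\<lambda>x. (norm (v x - \<psi> k x))\<^sup>2)"
    "(\<lambda>x. V x - P k x) \<in> borel_measurable (lebesgue_on S)"
    "integrable (lebesgue_on S) (\<lambda>x. (norm (V x - P k x))\<^sup>2)" for k
    using dL[of k] by (auto simp: Lp_space_2_iff)
  note v_small = integral_norm_tendsto_0_if_square[of "\<lambda>k x. v x - \<psi> k x", OF meas(1,2) lims(1)]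
  note V_small = integral_norm_tendsto_0_if_square[of "\<lambda>k x. V x - P k x", OF meas(3,4) lims(2)]
  show thesis
    by (rule that[OF \<psi> v_small(1)[unfolded real_norm_def] V_small(1)[unfolded P_def]
          v_small(2)[unfolded real_norm_def] V_small(2)[unfolded P_def]])
qed

text \<open>
  For a test function \<open>\<psi>\<close> the integral of \<open>U \<bullet> \<nabla>\<psi>\<close> equals minus the integral of the trace \<open>T\<close>
  of \<open>H\<close> times \<open>\<psi>\<close>. Both sides are continuous in \<open>\<psi>\<close>, so the identity survives the passage to
  \<open>v\<close>. The sign condition \<open>T \<le> 0 \<le> v\<close> is used only after this passage, because the
  approximating test functions may change sign.
\<close>

lemma superharmonic_pairing_nonneg:
  fixes U :: "real^'n \<Rightarrow> real^'n"
  assumes S: "open S" "bounded S"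
    and U: "\<And>i. has_C1_gradient (\<lambda>z. U z $ i) (\<lambda>z. H z $ i)"
    and trace: "\<And>z. (\<Sum>i\<in>UNIV. H z $ i $ i) \<le> 0"
    and v: "v \<in> W1_0 2 S" "AE x in lebesgue_on S. 0 \<le> v x"
    and V: "has_weak_gradient S v V" "V \<in> Lp_space 2 S"
  shows "0 \<le> (LINT x|lebesgue_on S. U x \<bullet> V x)"
proof -
  define T where "T = (\<lambda>z. \<Sum>i\<in>UNIV. H z $ i $ i)"
  have cT: "continuous_on UNIV T"
    unfolding T_def by (intro continuous_on_sum has_gradient_component_continuous[OF U])
  have cU: "continuous_on UNIV U"
    using has_gradient_continuous(1)[OF U] continuous_on_vec_lambda[of UNIV "\<lambda>i z. U z $ i"] by simp
  obtain CT where CT: "CT \<ge> 0" "\<And>x. x \<in> S \<Longrightarrow> norm (T x) \<le> CT"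
    using continuous_bounded_on[OF cT S(2)] by blast
  obtain CU where CU: "CU \<ge> 0" "\<And>x. x \<in> S \<Longrightarrow> norm (U x) \<le> CU"
    using continuous_bounded_on[OF cU S(2)] by blast
  obtain \<psi> where \<psi>: "\<And>k. \<psi> k \<in> test_functions S"
    and int: "\<And>k. integrable (lebesgue_on S) (\<lambda>x. \<bar>v x - \<psi> k x\<bar>)"
      "\<And>k. integrable (lebesgue_on S) (\<lambda>x. norm (V x - (\<chi> i. partial i (\<psi> k) x)))"
    and lim: "(\<lambda>k. LINT x|lebesgue_on S. \<bar>v x - \<psi> k x\<bar>) \<longlonglongrightarrow> 0"
      "(\<lambda>k. LINT x|lebesgue_on S. norm (V x - (\<chi> i. partial i (\<psi> k) x))) \<longlonglongrightarrow> 0"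
    by (rule W1_0_approximation[OF S v(1) V], rule that)
  define P where "P k = (\<lambda>x. \<chi> i. partial i (\<psi> k) x)" for k
  have P: "has_C1_gradient (\<psi> k) (P k)" for k
    unfolding P_def by (rule test_function_has_gradient[OF \<psi>])
  have L: "U \<in> Lp_space 2 S" "T \<in> Lp_space 2 S" "\<psi> k \<in> Lp_space 2 S" "P k \<in> Lp_space 2 S" for k
    using has_gradient_continuous[OF P] cT cU by (auto intro!: continuous_Lp_space[OF S])
  have vL: "v \<in> Lp_space 2 S"
    using v by (auto simp: W1_0_def W1_def)
  note ints = Lp_space_2_inner_integrable[OF L(1) V(2)] Lp_space_2_inner_integrable[OF L(1) L(4)]
    Lp_space_2_inner_integrable[OF L(2) vL] Lp_space_2_inner_integrable[OF L(2) L(3)]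
  (* The only place where the signs of the Laplacian and of v enter. *)
  have Tv: "0 \<le> - (LINT x|lebesgue_on S. T x \<bullet> v x)"
  proof -
    have "0 \<le> (LINT x|lebesgue_on S. - (T x \<bullet> v x))"
      using v(2) trace by (intro integral_nonneg_AE) (auto simp: T_def mult_nonpos_nonneg elim!: eventually_mono)
    then show ?thesis
      by simp
  qed
  have "- (CU * (LINT x|lebesgue_on S. norm (V x - P k x)) + CT * (LINT x|lebesgue_on S. \<bar>v x - \<psi> k x\<bar>))
      \<le> (LINT x|lebesgue_on S. U x \<bullet> V x)" for k
  proof -
    have "(LINT x|lebesgue_on S. U x \<bullet> P k x) = - (LINT x|lebesgue_on S. T x \<bullet> \<psi> k x)"
      using integral_gradient_inner_test_function[OF S U \<psi>, of k] by (simp add: P_def T_def)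
    moreover have "\<bar>LINT x|lebesgue_on S. U x \<bullet> V x - U x \<bullet> P k x\<bar> \<le>
        (LINT x|lebesgue_on S. CU * norm (V x - P k x))"
    proof (rule integral_abs_bound_integral)
      show "\<bar>U x \<bullet> V x - U x \<bullet> P k x\<bar> \<le> CU * norm (V x - P k x)" if "x \<in> space (lebesgue_on S)" for x
        using Cauchy_Schwarz_ineq2[of "U x" "V x - P k x"] CU(2)[of x] that
          mult_right_mono[of "norm (U x)" CU "norm (V x - P k x)"]
        by (simp add: inner_diff_right)
    qed (use ints int in \<open>auto simp: P_def\<close>)
    moreover have "\<bar>LINT x|lebesgue_on S. T x \<bullet> v x - T x \<bullet> \<psi> k x\<bar> \<le>
        (LINT x|lebesgue_on S. CT * \<bar>v x - \<psi> k x\<bar>)"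
    proof (rule integral_abs_bound_integral)
      show "\<bar>T x \<bullet> v x - T x \<bullet> \<psi> k x\<bar> \<le> CT * \<bar>v x - \<psi> k x\<bar>" if "x \<in> space (lebesgue_on S)" for x
        using CT(2)[of x] that mult_right_mono[of "\<bar>T x\<bar>" CT "\<bar>v x - \<psi> k x\<bar>"]
        by (simp add: abs_mult flip: right_diff_distrib)
    qed (use ints int in auto)
    ultimately show ?thesis
      using Tv ints by simp
  qed
  moreover have "(\<lambda>k. - (CU * (LINT x|lebesgue_on S. norm (V x - P k x)) +
      CT * (LINT x|lebesgue_on S. \<bar>v x - \<psi> k x\<bar>))) \<longlonglongrightarrow> - (CU * 0 + CT * 0)"
    using lim unfolding P_def by (intro tendsto_intros)
  ultimately show ?thesis
    by (intro LIMSEQ_le_const2[of _ 0]) auto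
qed

lemma zero_W1_0:
  fixes S :: "(real^'n) set"
  assumes S: "open S" "bounded S"
  shows "(\<lambda>x. 0) \<in> W1_0 2 S"
proof -
  have z: "has_C1_gradient (\<lambda>x::real^'n. 0) (\<lambda>x. 0)"
    by (simp add: has_C1_gradient_def)
  have w: "has_weak_gradient S (\<lambda>x. 0) (\<lambda>x. 0)"
    by (rule has_gradient_imp_weak[OF S z])
  have t: "(\<lambda>x. 0) \<in> test_functions S"
    using Ck_const by (auto simp: test_functions_def intro!: exI[of _ "{}"])
  have "(LINT x|lebesgue_on S. norm (weak_gradient S (\<lambda>x. 0) x) powr 2) = 0"
    using weak_gradient_AE[OF S(1) w] by (intro integral_eq_zero_AE) (auto elim!: eventually_mono)
  then have "W1_norm 2 S (\<lambda>x. 0 - 0) = 0"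
    by (simp add: W1_norm_def)
  moreover have "(\<lambda>x::real^'n. 0::real) \<in> Lp_space 2 S" "(\<lambda>x::real^'n. 0::real^'n) \<in> Lp_space 2 S"
    by (auto intro!: continuous_Lp_space[OF S] continuous_on_const)
  then have "(\<lambda>x. 0) \<in> W1 2 S"
    using w by (auto simp: W1_def)
  ultimately show ?thesis
    using t by (auto simp: W1_0_def intro!: exI[of _ "\<lambda>k x. 0"])
qed

text \<open>
  If \<open>u\<close> is both obstacle and boundary datum, every competitor is \<open>w = u + v\<close> with
  \<open>v \<ge> 0\<close> in \<open>W\<^sup>1\<^sup>,\<^sup>2\<close> with zero boundary values. The energy of \<open>w\<close> exceeds that of \<open>u\<close> by twice the
  pairing of the gradients of \<open>u\<close> and \<open>v\<close> plus a square.
\<close>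

lemma obstacle_solution_self:
  fixes S :: "(real^'n) set"
  assumes S: "open S" "bounded S"
    and u: "u \<in> Lp_space 2 S" "has_weak_gradient S u U" "U \<in> Lp_space 2 S"
    and super: "\<And>v V. v \<in> W1_0 2 S \<Longrightarrow> AE x in lebesgue_on S. 0 \<le> v x \<Longrightarrow>
      has_weak_gradient S v V \<Longrightarrow> V \<in> Lp_space 2 S \<Longrightarrow> 0 \<le> (LINT x|lebesgue_on S. U x \<bullet> V x)"
  shows "obstacle_solution S u u u"
proof -
  have uW: "u \<in> W1 2 S"
    using u by (auto simp: W1_def)
  have adm: "u \<in> admissible S u u"
    using uW zero_W1_0[OF S] by (simp add: admissible_def)
  have energy: "dirichlet_energy S w = (LINT x|lebesgue_on S. (norm (W x))\<^sup>2)"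
    if "has_weak_gradient S w W" "W \<in> Lp_space 2 S" for w W
  proof -
    have "AE x in lebesgue_on S. (norm (weak_gradient S w x))\<^sup>2 = (norm (W x))\<^sup>2"
      using weak_gradient_AE[OF S(1) that(1)] by eventually_elim simp
    then show ?thesis
      unfolding dirichlet_energy_def
      by (rule integral_cong_AE_lebesgue_on[OF S(1)]) (use that in \<open>auto simp: Lp_space_2_iff\<close>)
  qed
  have "dirichlet_energy S u \<le> dirichlet_energy S w" if w: "w \<in> admissible S u u" for w
  proof -
    obtain W where W: "has_weak_gradient S w W" "W \<in> Lp_space 2 S"
      using w by (auto simp: admissible_def W1_def)
    define V where "V = (\<lambda>x. W x - U x)"
    have V: "has_weak_gradient S (\<lambda>x. w x - u x) V" "V \<in> Lp_space 2 S"
      unfolding V_def using W u S by (auto intro: has_weak_gradient_diff Lp_space_2_diff)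
    have "AE x in lebesgue_on S. u x \<le> w x"
      using w by (simp add: admissible_def)
    then have "AE x in lebesgue_on S. 0 \<le> w x - u x"
      by eventually_elim simp
    then have "0 \<le> (LINT x|lebesgue_on S. U x \<bullet> V x)"
      using w V by (intro super) (auto simp: admissible_def)
    moreover have int: "integrable (lebesgue_on S) (\<lambda>x. U x \<bullet> V x)"
      using u V by (intro Lp_space_2_inner_integrable)
    ultimately have "(LINT x|lebesgue_on S. (norm (U x))\<^sup>2) \<le>
        (LINT x|lebesgue_on S. (norm (U x))\<^sup>2 + 2 * (U x \<bullet> V x))"
      using u by (simp add: Lp_space_2_iff)
    also have "\<dots> \<le> (LINT x|lebesgue_on S. (norm (W x))\<^sup>2)"
    proof (rule integral_mono)
      fix x
      have "(norm (W x))\<^sup>2 = (norm (U x))\<^sup>2 + 2 * (U x \<bullet> V x) + (norm (V x))\<^sup>2"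
        by (simp add: V_def power2_norm_eq_inner inner_diff inner_commute)
      then show "(norm (U x))\<^sup>2 + 2 * (U x \<bullet> V x) \<le> (norm (W x))\<^sup>2"
        by simp
    qed (use u W int in \<open>auto simp: Lp_space_2_iff\<close>)
    finally show ?thesis
      using energy[OF u(2,3)] energy[OF W] by simp
  qed
  then show ?thesis
    using uW adm by (auto simp: obstacle_solution_def is_arg_min_def not_less)
qed

section \<open>The cutoff and the smoothed absolute value\<close>

lemma flat_DERIV_chain [derivative_intros]:
  "(g has_real_derivative g') (at t) \<Longrightarrow>
    ((\<lambda>t. flat p (g t)) has_real_derivative flat (monom 1 2 * (p - pderiv p)) (g t) * g') (at t)"
  by (rule DERIV_chain2[OF flat_DERIV])

lemma flat_continuous: "continuous_on A (flat p)"
  by (meson DERIV_isCont continuous_at_imp_continuous_on flat_DERIV)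

lemma flat_1_mono: "0 < s \<Longrightarrow> s \<le> t \<Longrightarrow> flat 1 s \<le> flat 1 t"
  by (simp add: flat_def frac_le)

text \<open>
  The second derivative of \<open>sqrt (1 + s\<^sup>2)\<close>.
\<close>

definition profile :: "real \<Rightarrow> real" where
  "profile s = inverse (sqrt (1 + s\<^sup>2)) ^ 3"

lemma profile_pos: "0 < profile s"
  by (auto simp: profile_def intro!: add_pos_nonneg)

lemma profile_le_1: "profile s \<le> 1"
  unfolding profile_def by (intro power_le_one) (auto simp: inverse_le_1_iff)

text \<open>
  Composing \<open>flat 1\<close> with itself gives the cutoff: \<open>flat 1 (s\<^sup>2 - 1)\<close> is 0 for \<open>\<bar>s\<bar> \<le> 1\<close> and
  at least \<open>c = flat 1 3\<close> for \<open>\<bar>s\<bar> \<ge> 2\<close>, so \<open>flat 1 (c - flat 1 (s\<^sup>2 - 1))\<close> is a positive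
  constant in the first region and 0 in the second.
\<close>

lemma cutoff_exists:
  obtains w w' w'' :: "real \<Rightarrow> real" where
    "\<And>s. (w has_real_derivative w' s) (at s)" "\<And>s. (w' has_real_derivative w'' s) (at s)"
    "continuous_on UNIV w''" "\<And>s. \<bar>s\<bar> \<le> 1 \<Longrightarrow> w s = 1" "\<And>s. 2 \<le> \<bar>s\<bar> \<Longrightarrow> w s = 0"
proof -
  define p1 p2 :: "real poly" where "p1 = monom 1 2 * (1 - pderiv 1)" and "p2 = monom 1 2 * (p1 - pderiv p1)"
  define c K where "c = flat 1 3" and "K = flat 1 c"
  have c: "c > 0" and K: "K > 0"
    by (simp_all add: c_def K_def flat_def)
  define a a1 a2 where "a s = flat 1 (s\<^sup>2 - 1)" and "a1 s = flat p1 (s\<^sup>2 - 1) * (2 * s)"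
    and "a2 s = flat p2 (s\<^sup>2 - 1) * (2 * s) * (2 * s) + flat p1 (s\<^sup>2 - 1) * 2" for s
  have a: "(a has_real_derivative a1 s) (at s)" for s
    unfolding a_def a1_def p1_def by (auto intro!: derivative_eq_intros)
  have a1: "(a1 has_real_derivative a2 s) (at s)" for s
    unfolding a1_def a2_def p2_def by (auto intro!: derivative_eq_intros)
  define w w' w'' where "w s = flat 1 (c - a s) / K" and "w' s = flat p1 (c - a s) * (- a1 s) / K"
    and "w'' s = (flat p2 (c - a s) * (- a1 s) * (- a1 s) + flat p1 (c - a s) * (- a2 s)) / K" for s
  show thesis
  proof
    show "(w has_real_derivative w' s) (at s)" for s
      unfolding w_def w'_def p1_def using K by (auto intro!: derivative_eq_intros a simp: p1_def)
    show "(w' has_real_derivative w'' s) (at s)" for s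
      unfolding w'_def w''_def p2_def using K
      by (auto intro!: derivative_eq_intros a a1 simp: field_simps)
    have "continuous_on UNIV (\<lambda>s. flat p (s\<^sup>2 - 1))" for p
      by (intro continuous_on_compose2[OF flat_continuous[of UNIV p]] continuous_intros) auto
    moreover have "continuous_on UNIV a"
      using a by (meson DERIV_isCont continuous_at_imp_continuous_on)
    moreover have "continuous_on UNIV (\<lambda>s. flat p (c - a s))" for p
      using \<open>continuous_on UNIV a\<close>
      by (intro continuous_on_compose2[OF flat_continuous[of UNIV p]] continuous_intros) auto
    ultimately show "continuous_on UNIV w''"
      unfolding w''_def a1_def a2_def using K by (intro continuous_intros) auto
    show "w s = 1" if "\<bar>s\<bar> \<le> 1" for s
    proof -
      have "s\<^sup>2 \<le> 1"
        using that by (simp add: abs_square_le_1)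
      then show ?thesis
        using K by (simp add: w_def a_def flat_def[of 1 "s\<^sup>2 - 1"] K_def)
    qed
    show "w s = 0" if "2 \<le> \<bar>s\<bar>" for s
    proof -
      have "2\<^sup>2 \<le> s\<^sup>2"
        using that power_mono[of 2 "\<bar>s\<bar>" 2] by simp
      then have "c \<le> a s"
        unfolding c_def a_def by (intro flat_1_mono) auto
      then show ?thesis
        by (simp add: w_def flat_def)
    qed
  qed
qed

text \<open>
  The last two conditions say that the second derivative of \<open>M sqrt (1 + s\<^sup>2)\<close> dominates all the
  second order terms that the cutoff produces. This is what pays for the oscillation and keeps the
  layers below superharmonic.
\<close>

locale cutoff =
  fixes w w' w'' :: "real \<Rightarrow> real" and M :: real
  assumes w_deriv: "\<And>s. (w has_real_derivative w' s) (at s)"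
    and w'_deriv: "\<And>s. (w' has_real_derivative w'' s) (at s)"
    and w''_cont: "continuous_on UNIV w''"
    and w_inner: "\<And>s. \<bar>s\<bar> < 1 \<Longrightarrow> w s = 1" "\<And>s. \<bar>s\<bar> < 1 \<Longrightarrow> w' s = 0"
    and w_outer: "\<And>s. 2 < \<bar>s\<bar> \<Longrightarrow> w s = 0" "\<And>s. 2 < \<bar>s\<bar> \<Longrightarrow> w' s = 0"
    and M_pos: "0 < M"
    and w'_le: "\<And>s. \<bar>w' s\<bar> \<le> M * profile s"
    and w''_le: "\<And>s. \<bar>w'' s\<bar> + \<bar>w s\<bar> \<le> M * profile s"

lemma deriv_eq_0_if_locally_constant:
  fixes g :: "real \<Rightarrow> real"
  assumes "(g has_real_derivative d) (at s)" "open T" "s \<in> T" "\<And>t. t \<in> T \<Longrightarrow> g t = c"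
  shows "d = 0"
proof -
  have "((\<lambda>t. c) has_real_derivative 0) (at s)"
    by simp
  then have "(g has_real_derivative 0) (at s)"
    by (rule has_field_derivative_transform_within_open[of _ _ _ T]) (use assms in auto)
  then show ?thesis
    using assms(1) DERIV_unique by blast
qed

lemma cutoff_locale_exists: "\<exists>w w' w'' M. cutoff w w' w'' M"
proof -
  obtain w w' w'' :: "real \<Rightarrow> real" where d: "\<And>s. (w has_real_derivative w' s) (at s)"
      "\<And>s. (w' has_real_derivative w'' s) (at s)" and c: "continuous_on UNIV w''"
    and inner: "\<And>s. \<bar>s\<bar> \<le> 1 \<Longrightarrow> w s = 1" and outer: "\<And>s. 2 \<le> \<bar>s\<bar> \<Longrightarrow> w s = 0"
    using cutoff_exists by metis
  have inner': "w' s = 0" if "\<bar>s\<bar> < 1" for s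
    by (rule deriv_eq_0_if_locally_constant[OF d(1), of "{-1<..<1}" s 1]) (use that inner in auto)
  have o: "open {s::real. 2 < \<bar>s\<bar>}"
    by (intro open_Collect_less continuous_intros)
  have outer': "w' s = 0" if "2 < \<bar>s\<bar>" for s
    by (rule deriv_eq_0_if_locally_constant[OF d(1) o, of s 0]) (use that outer in auto)
  have outer'': "w'' s = 0" if "2 < \<bar>s\<bar>" for s
    by (rule deriv_eq_0_if_locally_constant[OF d(2) o, of s 0]) (use that outer' in auto)
  have cw: "continuous_on UNIV w" "continuous_on UNIV w'"
    using d by (meson DERIV_isCont continuous_at_imp_continuous_on)+
  have "bounded ((\<lambda>s. \<bar>w s\<bar> + \<bar>w' s\<bar> + \<bar>w'' s\<bar>) ` {-2..2})"
    using continuous_on_subset[OF cw(1)] continuous_on_subset[OF cw(2)] continuous_on_subset[OF c]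
    by (intro compact_imp_bounded compact_continuous_image continuous_intros) auto
  then obtain B where B: "B > 0" "\<And>s. s \<in> {-2..2} \<Longrightarrow> norm (\<bar>w s\<bar> + \<bar>w' s\<bar> + \<bar>w'' s\<bar>) \<le> B"
    unfolding bounded_pos by blast
  (* On [-2,2] the profile is at least 1/27, because sqrt (1 + 4) is at most 3; outside, the left side vanishes. *)
  have B': "\<bar>w s\<bar> + \<bar>w' s\<bar> + \<bar>w'' s\<bar> \<le> 27 * B * profile s" for s
  proof (cases "\<bar>s\<bar> \<le> 2")
    case True
    have "s\<^sup>2 \<le> 2\<^sup>2"
      using True power_mono[of "\<bar>s\<bar>" 2 2] by simp
    then have "sqrt (1 + s\<^sup>2) \<le> 3"
      by (intro real_le_lsqrt) auto
    moreover have "sqrt (1 + s\<^sup>2) > 0"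
      by (auto intro!: add_pos_nonneg)
    ultimately have "inverse 3 ^ 3 \<le> profile s"
      unfolding profile_def by (intro power_mono le_imp_inverse_le) auto
    then have "B \<le> 27 * B * profile s"
      using B(1) mult_left_mono[of "1 / 27" "profile s" "27 * B"] by (simp add: power_divide inverse_eq_divide)
    moreover have "s \<in> {-2..2}"
      using True by auto
    ultimately show ?thesis
      using B(2)[of s] unfolding real_norm_def by linarith
  next
    case False
    then show ?thesis
      using outer outer' outer'' B(1) profile_pos[of s] by (simp add: less_imp_le)
  qed
  have "cutoff w w' w'' (27 * B)"
  proof
    show "\<bar>w' s\<bar> \<le> 27 * B * profile s" "\<bar>w'' s\<bar> + \<bar>w s\<bar> \<le> 27 * B * profile s" for s
      using B'[of s] by linarith+
  qed (use d c inner inner' outer outer' B in auto)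
  then show ?thesis
    by blast
qed

lemma has_gradient_separated:
  fixes i j :: "'n::finite"
  assumes P: "\<And>t. (P has_real_derivative P' t) (at t)" "continuous_on UNIV P'"
    and Q: "\<And>t. (Q has_real_derivative Q' t) (at t)" "continuous_on UNIV Q'"
    and R: "\<And>t. (R has_real_derivative R' t) (at t)" "continuous_on UNIV R'"
  shows "has_C1_gradient (\<lambda>z. P (z $ i) + Q (z $ i) * R (z $ j))
    (\<lambda>z. (P' (z $ i) + Q' (z $ i) * R (z $ j)) *\<^sub>R axis i 1 + (Q (z $ i) * R' (z $ j)) *\<^sub>R axis j 1)"
proof -
  define V where "V = (\<lambda>z. P' (z $ i) *\<^sub>R axis i (1::real))"
  define W where "W = (\<lambda>z. Q (z $ i) *\<^sub>R (R' (z $ j) *\<^sub>R axis j (1::real)) + R (z $ j) *\<^sub>R (Q' (z $ i) *\<^sub>R axis i 1))"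
  have V: "has_C1_gradient (\<lambda>z. P (z $ i)) V"
    unfolding V_def by (rule has_gradient_coordinate[OF P])
  have W: "has_C1_gradient (\<lambda>z. Q (z $ i) * R (z $ j)) W"
    unfolding W_def by (rule has_gradient_mult[OF has_gradient_coordinate[OF Q] has_gradient_coordinate[OF R]])
  have "has_C1_gradient (\<lambda>z. P (z $ i) + Q (z $ i) * R (z $ j)) (\<lambda>z. V z + W z)"
    using V W unfolding has_C1_gradient_def inner_add_left
    by (auto intro!: has_derivative_add continuous_on_add)
  moreover have "V z + W z = (P' (z $ i) + Q' (z $ i) * R (z $ j)) *\<^sub>R axis i 1 + (Q (z $ i) * R' (z $ j)) *\<^sub>R axis j 1" for z
    by (simp add: V_def W_def scaleR_add_left mult.commute)
  ultimately show ?thesis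
    by simp
qed

lemma sqrt_pos: "r > 0 \<Longrightarrow> 0 < sqrt (r\<^sup>2 + x\<^sup>2)"
  by (auto intro!: add_pos_nonneg)

text \<open>
  The first and the second derivative of \<open>sqrt (r\<^sup>2 + x\<^sup>2)\<close>, a smoothing of \<open>\<bar>x\<bar>\<close> at scale \<open>r\<close>.
\<close>

definition soft_abs1 :: "real \<Rightarrow> real \<Rightarrow> real" where
  "soft_abs1 r x = x / sqrt (r\<^sup>2 + x\<^sup>2)"

definition soft_abs2 :: "real \<Rightarrow> real \<Rightarrow> real" where
  "soft_abs2 r x = r\<^sup>2 / sqrt (r\<^sup>2 + x\<^sup>2) ^ 3"

lemma soft_abs_deriv:
  assumes "r > 0"
  shows "((\<lambda>x. sqrt (r\<^sup>2 + x\<^sup>2)) has_real_derivative soft_abs1 r x) (at x)"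
    "(soft_abs1 r has_real_derivative soft_abs2 r x) (at x)"
proof -
  have pos: "0 < r\<^sup>2 + x\<^sup>2"
    using assms by (simp add: add_pos_nonneg)
  show d: "((\<lambda>x. sqrt (r\<^sup>2 + x\<^sup>2)) has_real_derivative soft_abs1 r x) (at x)"
    unfolding soft_abs1_def using pos by (auto intro!: derivative_eq_intros simp: field_simps)
  define q where "q = sqrt (r\<^sup>2 + x\<^sup>2)"
  have q: "q > 0" "q * q = r\<^sup>2 + x\<^sup>2"
    using pos by (simp_all add: q_def)
  have "((\<lambda>x. x / sqrt (r\<^sup>2 + x\<^sup>2)) has_real_derivative
      (1 * sqrt (r\<^sup>2 + x\<^sup>2) - x * soft_abs1 r x) / (sqrt (r\<^sup>2 + x\<^sup>2) * sqrt (r\<^sup>2 + x\<^sup>2))) (at x)"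
    using pos by (intro DERIV_divide DERIV_ident d) auto
  moreover have "(1 * q - x * (x / q)) / (q * q) = r\<^sup>2 / q ^ 3"
  proof -
    have "1 * q - x * (x / q) = (q * q - x\<^sup>2) / q"
      using q(1) by (simp add: field_simps power2_eq_square)
    also have "\<dots> = r\<^sup>2 / q"
      by (simp add: q(2))
    finally show ?thesis
      by (simp add: power3_eq_cube)
  qed
  ultimately show "(soft_abs1 r has_real_derivative soft_abs2 r x) (at x)"
    by (simp add: soft_abs1_def[abs_def] soft_abs2_def flip: q_def)
qed

lemma soft_abs1_le_1: "\<bar>soft_abs1 r x\<bar> \<le> 1"
proof -
  have "\<bar>x\<bar> \<le> sqrt (r\<^sup>2 + x\<^sup>2)"
    by (rule real_le_rsqrt) simp
  moreover from this have "x \<noteq> 0 \<Longrightarrow> 0 < sqrt (r\<^sup>2 + x\<^sup>2)"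
    by linarith
  ultimately show ?thesis
    by (cases "x = 0") (simp_all add: soft_abs1_def abs_of_pos divide_le_eq_1_pos abs_divide del: real_sqrt_gt_0_iff)
qed

lemma soft_abs2_nonneg: "0 \<le> soft_abs2 r x"
  by (simp add: soft_abs2_def)

lemma soft_abs2_continuous: "r > 0 \<Longrightarrow> continuous_on A (soft_abs2 r)"
  unfolding soft_abs2_def[abs_def] using sqrt_pos[of r] by (intro continuous_intros) (auto simp: less_le)

lemma soft_abs2_eq_profile:
  assumes "r > 0"
  shows "soft_abs2 r x = profile (x / r) / r"
proof -
  have "r\<^sup>2 + x\<^sup>2 = r\<^sup>2 * (1 + (x / r)\<^sup>2)"
    using assms by (simp add: field_simps)
  then have "sqrt (r\<^sup>2 + x\<^sup>2) = r * sqrt (1 + (x / r)\<^sup>2)"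
    using assms by (simp add: real_sqrt_mult)
  moreover have "r\<^sup>2 / (r * q) ^ 3 = inverse q ^ 3 / r" if "q > 0" for q
    using assms that by (simp add: power2_eq_square power3_eq_cube field_simps)
  moreover have "sqrt (1 + (x / r)\<^sup>2) > 0"
    by (auto intro!: add_pos_nonneg)
  ultimately show ?thesis
    by (simp only: soft_abs2_def profile_def)
qed

lemma soft_abs2_le: "x \<noteq> 0 \<Longrightarrow> soft_abs2 r x \<le> r\<^sup>2 / \<bar>x\<bar> ^ 3"
proof -
  assume "x \<noteq> 0"
  moreover have "\<bar>x\<bar> \<le> sqrt (r\<^sup>2 + x\<^sup>2)"
    by (rule real_le_rsqrt) simp
  moreover from calculation have "0 < sqrt (r\<^sup>2 + x\<^sup>2)"
    by linarith
  ultimately show ?thesis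
    unfolding soft_abs2_def by (intro divide_left_mono power_mono mult_pos_pos zero_less_power) auto
qed

text \<open>
  Integrating by parts against a fixed bump that is positive on the ball trades the second
  derivative of \<open>sqrt (r\<^sup>2 + x\<^sup>2)\<close> for the first one, which is bounded by 1 for every \<open>r\<close>.
\<close>

lemma soft_abs2_integral_bounded:
  fixes i :: "'n::finite"
  shows "\<exists>C. \<forall>r>0. (LINT z|lebesgue_on (ball (0::real^'n) 1). soft_abs2 r (z $ i)) \<le> C"
proof -
  define \<zeta> :: "real^'n \<Rightarrow> real" where "\<zeta> = box_bump 0 (\<chi> k. - 2) (\<chi> k. 2)"
  have \<zeta>: "\<zeta> \<in> test_functions UNIV"
    unfolding \<zeta>_def by (rule box_bump_test_function) simp
  have c\<zeta>: "continuous_on A \<zeta>" "continuous_on A (partial i \<zeta>)" for A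
    using has_gradient_continuous(1)[OF test_function_has_gradient] \<zeta> partial_test_function by blast+
  have "cball (0::real^'n) 1 \<subseteq> box (\<chi> k. - 2) (\<chi> k. 2)"
  proof
    fix z :: "real^'n" assume "z \<in> cball 0 1"
    then have "\<bar>z $ k\<bar> \<le> 1" for k
      using component_le_norm_cart[of z k] by simp
    then have "- 2 < z $ k \<and> z $ k < 2" for k
      by (smt (verit))
    then show "z \<in> box (\<chi> k. - 2) (\<chi> k. 2)"
      by (simp add: mem_box_cart)
  qed
  then have pos: "0 < \<zeta> z" if "z \<in> cball 0 1" for z
    using that box_bump_pos unfolding \<zeta>_def by blast
  obtain z0 where z0: "z0 \<in> cball 0 1" "\<And>z. z \<in> cball 0 1 \<Longrightarrow> \<zeta> z0 \<le> \<zeta> z"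
    using continuous_attains_inf[of "cball (0::real^'n) 1" \<zeta>] c\<zeta> by auto
  define c where "c = \<zeta> z0"
  have c: "c > 0" "\<And>z. z \<in> ball 0 1 \<Longrightarrow> c \<le> \<zeta> z"
    using pos z0 by (auto simp: c_def)
  obtain K where K: "compact K" "\<And>z. z \<notin> K \<Longrightarrow> \<zeta> z = 0"
    using \<zeta> by (auto simp: test_functions_def)
  obtain K' where K': "compact K'" "\<And>z. z \<notin> K' \<Longrightarrow> partial i \<zeta> z = 0"
    using partial_test_function[OF \<zeta>, of i] by (auto simp: test_functions_def)
  have \<zeta>0: "0 \<le> \<zeta> z" for z
    by (simp add: \<zeta>_def box_bump_bounds)
  have "(LINT z|lebesgue_on (ball 0 1). soft_abs2 r (z $ i)) \<le> (LINT z|lebesgue. \<bar>partial i \<zeta> z\<bar>) / c"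
    if r: "r > 0" for r
  proof -
    have cs: "continuous_on UNIV (\<lambda>z::real^'n. soft_abs2 r (z $ i))"
      by (intro continuous_on_compose2[OF soft_abs2_continuous[OF r, of UNIV]] continuous_intros) auto
    have cs1: "continuous_on UNIV (\<lambda>z::real^'n. soft_abs1 r (z $ i))"
      using has_gradient_continuous(1)[OF has_gradient_coordinate[OF soft_abs_deriv(2)[OF r] soft_abs2_continuous[OF r]]] .
    have int: "integrable (lebesgue_on UNIV) (\<lambda>z. soft_abs2 r (z $ i) * \<zeta> z)"
      "integrable (lebesgue_on UNIV) (\<lambda>z. soft_abs1 r (z $ i) * partial i \<zeta> z)"
      "integrable (lebesgue_on UNIV) (\<lambda>z. \<bar>partial i \<zeta> z\<bar>)"
      using integral_lebesgue_on_compact_support(2)[of _ K UNIV]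
        integral_lebesgue_on_compact_support(2)[of _ K' UNIV] K K' cs cs1 c\<zeta>
      by (simp_all add: continuous_on_mult continuous_on_rabs)
    have "c * (LINT z|lebesgue_on (ball 0 1). soft_abs2 r (z $ i)) =
        (LINT z|lebesgue. indicator (ball 0 1) z *\<^sub>R (c * soft_abs2 r (z $ i)))"
      by (subst integral_restrict_space[symmetric]) auto
    also have "\<dots> \<le> (LINT z|lebesgue. soft_abs2 r (z $ i) * \<zeta> z)"
    proof (rule integral_mono)
      have "integrable (lebesgue_on (ball 0 1)) (\<lambda>z. c * soft_abs2 r (z $ i))"
        using cs by (intro continuous_integrable_lebesgue_on continuous_intros) auto
      then show "integrable lebesgue (\<lambda>z. indicator (ball 0 1) z *\<^sub>R (c * soft_abs2 r (z $ i)))"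
        by (rule iffD1[OF integrable_restrict_space, rotated]) simp
      show "indicator (ball 0 1) z *\<^sub>R (c * soft_abs2 r (z $ i)) \<le> soft_abs2 r (z $ i) * \<zeta> z" for z
        using c(2)[of z] \<zeta>0[of z] soft_abs2_nonneg[of r "z $ i"]
        by (auto simp: indicator_def mult.commute[of c] intro!: mult_left_mono)
    qed (use int in \<open>simp add: lebesgue_on_UNIV_eq\<close>)
    also have "\<dots> = - (LINT z|lebesgue. soft_abs1 r (z $ i) * partial i \<zeta> z)"
      using integral_by_parts_test_function[OF
          has_gradient_coordinate[OF soft_abs_deriv(2)[OF r] soft_abs2_continuous[OF r]] \<zeta>, of i i]
      by (simp add: lebesgue_on_UNIV_eq)
    also have "\<dots> \<le> (LINT z|lebesgue. \<bar>partial i \<zeta> z\<bar>)"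
    proof -
      have "\<bar>LINT z|lebesgue. soft_abs1 r (z $ i) * partial i \<zeta> z\<bar> \<le> (LINT z|lebesgue. \<bar>partial i \<zeta> z\<bar>)"
        using int soft_abs1_le_1
        by (intro integral_abs_bound_integral) (auto simp: abs_mult lebesgue_on_UNIV_eq intro!: mult_left_le_one_le)
      then show ?thesis
        by linarith
    qed
    finally show ?thesis
      using c(1) by (simp add: pos_le_divide_eq mult.commute)
  qed
  then show ?thesis
    by blast
qed

section \<open>A single oscillating layer\<close>

lemma norm_axis: "norm (axis k x :: 'b::real_normed_vector^'n) = norm x"
  by (simp add: norm_vec_def L2_set_def axis_def if_distrib[of norm] if_distrib[of "\<lambda>t. t\<^sup>2"] cong: if_cong)

locale wave = cutoff w w' w'' M for w w' w'' M +
  fixes i j :: "'n::finite"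
  assumes ij: "i \<noteq> j"
begin

text \<open>
  With \<open>x = z $ i\<close> and \<open>y = z $ j\<close>, this is a smoothed concave wedge \<open>- M \<bar>x\<bar>\<close>, corrugated in the
  direction \<open>y\<close> with amplitude and period of order \<open>r\<close> where \<open>\<bar>x\<bar> < 2 r\<close>. Its gradient is bounded
  independently of \<open>r\<close>, while its second derivatives are of size \<open>1 / r\<close> near \<open>x = 0\<close>, where the
  second derivative in \<open>y\<close> takes both signs.
\<close>

definition layer :: "real \<Rightarrow> real^'n \<Rightarrow> real" where
  "layer r z = - (M * sqrt (r\<^sup>2 + (z $ i)\<^sup>2) + r * w (z $ i / r) * cos (z $ j / r))"

definition layer_xx :: "real \<Rightarrow> real^'n \<Rightarrow> real" where
  "layer_xx r z = - (M * soft_abs2 r (z $ i) + w'' (z $ i / r) / r * cos (z $ j / r))"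

definition layer_xy :: "real \<Rightarrow> real^'n \<Rightarrow> real" where
  "layer_xy r z = w' (z $ i / r) * sin (z $ j / r) / r"

definition layer_yy :: "real \<Rightarrow> real^'n \<Rightarrow> real" where
  "layer_yy r z = w (z $ i / r) * cos (z $ j / r) / r"

definition layer_grad :: "real \<Rightarrow> real^'n \<Rightarrow> real^'n" where
  "layer_grad r z =
     - (M * soft_abs1 r (z $ i) + w' (z $ i / r) * cos (z $ j / r)) *\<^sub>R axis i 1 +
     (w (z $ i / r) * sin (z $ j / r)) *\<^sub>R axis j 1"

definition layer_hess :: "real \<Rightarrow> real^'n \<Rightarrow> real^'n^'n" where
  "layer_hess r z = layer_xx r z *\<^sub>R axis i (axis i 1) +
     layer_xy r z *\<^sub>R (axis i (axis j 1) + axis j (axis i 1)) +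
     layer_yy r z *\<^sub>R axis j (axis j 1)"

lemma w_continuous: "continuous_on A w" "continuous_on A w'" "continuous_on A w''"
  using w_deriv w'_deriv w''_cont
  by (meson DERIV_isCont continuous_at_imp_continuous_on continuous_on_subset subset_UNIV)+

lemma rescaled_continuous:
  assumes "continuous_on UNIV g"
  shows "continuous_on A (\<lambda>t::real. g (t / r) :: real)"
proof -
  have "continuous_on A (\<lambda>t. t * inverse r)"
    by (intro continuous_intros)
  then show ?thesis
    using continuous_on_compose2[OF assms, of A "\<lambda>t. t * inverse r"] by (simp add: divide_inverse)
qed

lemma layer_has_gradient:
  assumes r: "r > 0"
  shows "has_C1_gradient (layer r) (layer_grad r)"
proof -
  have "has_C1_gradient (\<lambda>z. - M * sqrt (r\<^sup>2 + (z $ i)\<^sup>2) + (- r * w (z $ i / r)) * cos (z $ j / r))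
    (\<lambda>z. (- M * soft_abs1 r (z $ i) + (- w' (z $ i / r)) * cos (z $ j / r)) *\<^sub>R axis i 1 +
      ((- r * w (z $ i / r)) * (- sin (z $ j / r) / r)) *\<^sub>R axis j 1)"
  proof (rule has_gradient_separated)
    show "((\<lambda>x. - M * sqrt (r\<^sup>2 + x\<^sup>2)) has_real_derivative - M * soft_abs1 r t) (at t)" for t
      by (rule DERIV_cmult[OF soft_abs_deriv(1)[OF r]])
    show "continuous_on UNIV (\<lambda>t. - M * soft_abs1 r t)"
      using soft_abs_deriv(2)[OF r]
      by (intro continuous_intros) (meson DERIV_isCont continuous_at_imp_continuous_on)
    show "((\<lambda>t. - r * w (t / r)) has_real_derivative - w' (t / r)) (at t)" for t
      using r by (auto intro!: derivative_eq_intros DERIV_chain2[OF w_deriv])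
    show "continuous_on UNIV (\<lambda>t. - w' (t / r))"
      by (intro continuous_intros rescaled_continuous w_continuous)
    show "((\<lambda>t. cos (t / r)) has_real_derivative - sin (t / r) / r) (at t)" for t
      using r by (auto intro!: derivative_eq_intros)
    show "continuous_on UNIV (\<lambda>t. - sin (t / r) / r)"
      using r by (intro continuous_intros) auto
  qed
  then show ?thesis
    using r by (simp add: layer_def[abs_def] layer_grad_def[abs_def])
qed

lemma layer_grad_nth:
  "layer_grad r z $ k =
    (if k = i then - (M * soft_abs1 r (z $ i) + w' (z $ i / r) * cos (z $ j / r))
     else if k = j then w (z $ i / r) * sin (z $ j / r) else 0)"
  using ij by (auto simp: layer_grad_def axis_def)

lemma layer_hess_nth:
  "layer_hess r z $ k =
    (if k = i then layer_xx r z *\<^sub>R axis i 1 + layer_xy r z *\<^sub>R axis j 1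
     else if k = j then layer_xy r z *\<^sub>R axis i 1 + layer_yy r z *\<^sub>R axis j 1 else 0)"
  using ij by (auto simp: layer_hess_def axis_def vec_eq_iff)

lemma layer_grad_has_gradient:
  assumes r: "r > 0"
  shows "has_C1_gradient (\<lambda>z. layer_grad r z $ k) (\<lambda>z. layer_hess r z $ k)"
proof -
  have xx: "has_C1_gradient (\<lambda>z. - M * soft_abs1 r (z $ i) + (- w' (z $ i / r)) * cos (z $ j / r))
    (\<lambda>z. (- M * soft_abs2 r (z $ i) + (- w'' (z $ i / r) / r) * cos (z $ j / r)) *\<^sub>R axis i 1 +
      ((- w' (z $ i / r)) * (- sin (z $ j / r) / r)) *\<^sub>R axis j 1)"
  proof (rule has_gradient_separated)
    show "((\<lambda>x. - M * soft_abs1 r x) has_real_derivative - M * soft_abs2 r t) (at t)" for t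
      by (rule DERIV_cmult[OF soft_abs_deriv(2)[OF r]])
    show "continuous_on UNIV (\<lambda>t. - M * soft_abs2 r t)"
      using soft_abs2_continuous[OF r] by (intro continuous_intros)
    show "((\<lambda>t. - w' (t / r)) has_real_derivative - w'' (t / r) / r) (at t)" for t
      using r by (auto intro!: derivative_eq_intros DERIV_chain2[OF w'_deriv])
    show "continuous_on UNIV (\<lambda>t. - w'' (t / r) / r)"
      using r by (intro continuous_intros rescaled_continuous w_continuous) auto
    show "((\<lambda>t. cos (t / r)) has_real_derivative - sin (t / r) / r) (at t)" for t
      using r by (auto intro!: derivative_eq_intros)
    show "continuous_on UNIV (\<lambda>t. - sin (t / r) / r)"
      using r by (intro continuous_intros) auto
  qed
  have yy: "has_C1_gradient (\<lambda>z. 0 + w (z $ i / r) * sin (z $ j / r))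
    (\<lambda>z. (0 + (w' (z $ i / r) / r) * sin (z $ j / r)) *\<^sub>R axis i 1 +
      (w (z $ i / r) * (cos (z $ j / r) / r)) *\<^sub>R axis j 1)"
  proof (rule has_gradient_separated)
    show "((\<lambda>t. w (t / r)) has_real_derivative w' (t / r) / r) (at t)" for t
    proof -
      have "((\<lambda>t. t / r) has_real_derivative 1 / r) (at t)"
        using r by (auto intro!: derivative_eq_intros)
      from DERIV_chain2[OF w_deriv this] show ?thesis
        by simp
    qed
    show "continuous_on UNIV (\<lambda>t. w' (t / r) / r)"
      using r by (intro continuous_intros rescaled_continuous w_continuous) auto
    show "((\<lambda>t. sin (t / r)) has_real_derivative cos (t / r) / r) (at t)" for t
      using r by (auto intro!: derivative_eq_intros)
    show "continuous_on UNIV (\<lambda>t. cos (t / r) / r)"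
      using r by (intro continuous_intros) auto
  qed auto
  consider "k = i" | "k = j" | "k \<noteq> i" "k \<noteq> j"
    by blast
  then show ?thesis
  proof cases
    case 1
    then show ?thesis
      using xx by (simp add: layer_grad_nth layer_hess_nth layer_xx_def layer_xy_def)
  next
    case 2
    then show ?thesis
      using yy ij by (simp add: layer_grad_nth layer_hess_nth layer_yy_def layer_xy_def)
  next
    case 3
    then show ?thesis
      by (simp add: layer_grad_nth layer_hess_nth has_C1_gradient_def)
  qed
qed

lemma w_bounds: "\<bar>w s\<bar> \<le> M" "\<bar>w' s\<bar> \<le> M"
proof -
  have "M * profile s \<le> M"
    using profile_le_1[of s] M_pos by simp
  then show "\<bar>w s\<bar> \<le> M" "\<bar>w' s\<bar> \<le> M"
    using w'_le[of s] w''_le[of s] by linarith+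
qed

lemma layer_bound:
  assumes r: "0 < r" "r \<le> 1" and z: "z \<in> ball 0 1"
  shows "\<bar>layer r z\<bar> \<le> 3 * M"
proof -
  have "\<bar>z $ i\<bar> \<le> 1"
    using z component_le_norm_cart[of z i] by simp
  then have "sqrt (r\<^sup>2 + (z $ i)\<^sup>2) \<le> 2"
    using r abs_square_le_1[of r] abs_square_le_1[of "z $ i"] by (intro real_le_lsqrt) auto
  then have "M * sqrt (r\<^sup>2 + (z $ i)\<^sup>2) \<le> M * 2"
    using M_pos by simp
  moreover have "\<bar>r * w (z $ i / r) * cos (z $ j / r)\<bar> \<le> 1 * M * 1"
    unfolding abs_mult using r w_bounds M_pos by (intro mult_mono) auto
  moreover have "0 \<le> M * sqrt (r\<^sup>2 + (z $ i)\<^sup>2)"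
    using M_pos by simp
  ultimately show ?thesis
    unfolding layer_def by linarith
qed

lemma layer_grad_bound: "norm (layer_grad r z) \<le> 3 * M"
proof -
  have "norm (layer_grad r z) \<le> \<bar>M * soft_abs1 r (z $ i) + w' (z $ i / r) * cos (z $ j / r)\<bar> +
      \<bar>w (z $ i / r) * sin (z $ j / r)\<bar>"
    unfolding layer_grad_def by (rule order_trans[OF norm_triangle_ineq]) (simp add: norm_axis)
  moreover have "\<bar>M * soft_abs1 r (z $ i)\<bar> \<le> M * 1"
    unfolding abs_mult using M_pos soft_abs1_le_1 by (intro mult_mono) auto
  moreover have "\<bar>w' (z $ i / r) * cos (z $ j / r)\<bar> \<le> M * 1"
    unfolding abs_mult using w_bounds M_pos by (intro mult_mono) auto
  moreover have "\<bar>w (z $ i / r) * sin (z $ j / r)\<bar> \<le> M * 1"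
    unfolding abs_mult using w_bounds M_pos by (intro mult_mono) auto
  ultimately show ?thesis
    by linarith
qed

lemma second_derivative_bounds:
  assumes r: "r > 0"
  shows "\<bar>w' (z $ i / r) * t / r\<bar> \<le> M * soft_abs2 r (z $ i) * \<bar>t\<bar>"
    "(\<bar>w'' (z $ i / r)\<bar> + \<bar>w (z $ i / r)\<bar>) / r \<le> M * soft_abs2 r (z $ i)"
proof -
  have "\<bar>w' (z $ i / r)\<bar> / r \<le> M * soft_abs2 r (z $ i)"
    using w'_le[of "z $ i / r"] r by (simp add: soft_abs2_eq_profile divide_right_mono)
  then have "\<bar>w' (z $ i / r)\<bar> / r * \<bar>t\<bar> \<le> M * soft_abs2 r (z $ i) * \<bar>t\<bar>"
    by (rule mult_right_mono) simp
  then show "\<bar>w' (z $ i / r) * t / r\<bar> \<le> M * soft_abs2 r (z $ i) * \<bar>t\<bar>"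
    using r by (simp add: abs_mult)
  show "(\<bar>w'' (z $ i / r)\<bar> + \<bar>w (z $ i / r)\<bar>) / r \<le> M * soft_abs2 r (z $ i)"
    using w''_le[of "z $ i / r"] r by (simp add: soft_abs2_eq_profile divide_right_mono)
qed

text \<open>
  The negative second derivative of the wedge outweighs the oscillating terms, by the
  choice of \<open>M\<close>.
\<close>

lemma layer_second_derivative_bounds:
  assumes r: "r > 0"
  shows "layer_xx r z + layer_yy r z \<le> 0"
    "\<bar>layer_xx r z\<bar> \<le> 2 * M * soft_abs2 r (z $ i)"
    "\<bar>layer_xy r z\<bar> \<le> M * soft_abs2 r (z $ i)"
    "\<bar>layer_yy r z\<bar> \<le> M * soft_abs2 r (z $ i)"
proof -
  define a b where "a = w'' (z $ i / r) / r" and "b = w (z $ i / r) / r"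
  define c where "c = cos (z $ j / r)"
  have ab: "\<bar>a\<bar> + \<bar>b\<bar> \<le> M * soft_abs2 r (z $ i)"
    using second_derivative_bounds(2)[OF r, of z] r by (simp add: a_def b_def add_divide_distrib)
  have ac: "\<bar>a * c\<bar> \<le> \<bar>a\<bar>" and bc: "\<bar>b * c\<bar> \<le> \<bar>b\<bar>"
    unfolding abs_mult c_def by (auto intro!: mult_left_le abs_cos_le_one)
  have xx: "layer_xx r z = - (M * soft_abs2 r (z $ i) + a * c)" and yy: "layer_yy r z = b * c"
    by (simp_all add: layer_xx_def layer_yy_def a_def b_def c_def)
  show "layer_xx r z + layer_yy r z \<le> 0" "\<bar>layer_xx r z\<bar> \<le> 2 * M * soft_abs2 r (z $ i)"
    "\<bar>layer_yy r z\<bar> \<le> M * soft_abs2 r (z $ i)"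
    unfolding xx yy using ab ac bc by linarith+
  have "M * soft_abs2 r (z $ i) * \<bar>sin (z $ j / r)\<bar> \<le> M * soft_abs2 r (z $ i)"
    using M_pos soft_abs2_nonneg abs_sin_le_one by (intro mult_left_le) auto
  then show "\<bar>layer_xy r z\<bar> \<le> M * soft_abs2 r (z $ i)"
    using second_derivative_bounds(1)[OF r, of z "sin (z $ j / r)"] unfolding layer_xy_def by linarith
qed

lemma layer_superharmonic:
  assumes "r > 0"
  shows "(\<Sum>k\<in>UNIV. layer_hess r z $ k $ k) \<le> 0"
proof -
  have "(\<Sum>k\<in>UNIV. layer_hess r z $ k $ k) = (\<Sum>k\<in>{i, j}. layer_hess r z $ k $ k)"
    by (rule sum.mono_neutral_right) (auto simp: layer_hess_nth)
  also have "\<dots> = layer_xx r z + layer_yy r z"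
    using ij by (simp add: layer_hess_nth axis_def)
  finally show ?thesis
    using layer_second_derivative_bounds(1)[OF assms, of z] by simp
qed

lemma layer_hess_bound:
  assumes "r > 0"
  shows "norm (layer_hess r z) \<le> 5 * M * soft_abs2 r (z $ i)"
proof -
  have n: "norm (axis k (axis l (1::real)) :: real^'n^'n) = 1" for k l
    by (simp add: norm_axis)
  have "norm (layer_hess r z) \<le> \<bar>layer_xx r z\<bar> + \<bar>layer_xy r z\<bar> * 2 + \<bar>layer_yy r z\<bar>"
  proof -
    have "norm (axis i (axis j 1) + axis j (axis i 1) :: real^'n^'n) \<le> 1 + 1"
      by (rule order_trans[OF norm_triangle_ineq]) (simp add: n)
    then have "\<bar>layer_xy r z\<bar> * norm (axis i (axis j 1) + axis j (axis i 1) :: real^'n^'n) \<le> \<bar>layer_xy r z\<bar> * 2"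
      by (intro mult_left_mono) auto
    then show ?thesis
      unfolding layer_hess_def
      by (intro order_trans[OF norm_triangle_ineq] add_mono order_trans[OF norm_triangle_ineq])
         (simp_all add: n)
  qed
  then show ?thesis
    using layer_second_derivative_bounds[OF assms, of z] by linarith
qed

end

section \<open>Series of superharmonic functions\<close>

text \<open>
  The hypotheses for integrating a series term by term.
\<close>

definition L1_series :: "(real^'n) set \<Rightarrow> (nat \<Rightarrow> real^'n \<Rightarrow> 'b::euclidean_space) \<Rightarrow> bool" where
  "L1_series S F \<longleftrightarrow> (\<forall>k. integrable (lebesgue_on S) (F k)) \<and>
     (AE x in lebesgue_on S. summable (\<lambda>k. norm (F k x))) \<and>
     summable (\<lambda>k. LINT x|lebesgue_on S. norm (F k x))"

lemma L1_series_integrable: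
  assumes "L1_series S F"
  shows "integrable (lebesgue_on S) (\<lambda>x. \<Sum>k. F k x)"
  using assms unfolding L1_series_def by (intro integrable_suminf) auto

text \<open>
  The linear map \<open>L\<close> will be the evaluation of a component of a gradient or Hessian.
\<close>

lemma L1_series_mult_sums:
  fixes F :: "nat \<Rightarrow> real^'n \<Rightarrow> 'b::euclidean_space" and L :: "'b \<Rightarrow> real" and g :: "real^'n \<Rightarrow> real"
  assumes F: "L1_series S F" and L: "bounded_linear L" and g: "g \<in> borel_measurable (lebesgue_on S)"
    and B: "\<And>x. x \<in> S \<Longrightarrow> \<bar>g x\<bar> \<le> B"
  shows "(\<lambda>k. LINT x|lebesgue_on S. L (F k x) * g x) sums (LINT x|lebesgue_on S. L (\<Sum>k. F k x) * g x)"
proof -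
  interpret L: bounded_linear L
    by (rule L)
  have F': "integrable (lebesgue_on S) (F k)" "AE x in lebesgue_on S. summable (\<lambda>k. norm (F k x))"
    "summable (\<lambda>k. LINT x|lebesgue_on S. norm (F k x))" for k
    using F by (auto simp: L1_series_def)
  obtain K where K: "K \<ge> 0" "\<And>y. norm (L y) \<le> norm y * K"
    using L.nonneg_bounded by blast
  have bound: "norm (L (F k x) * g x) \<le> K * B * norm (F k x)" if "x \<in> space (lebesgue_on S)" for k x
  proof -
    have "\<bar>g x\<bar> \<le> B"
      using B that by simp
    then have "\<bar>L (F k x)\<bar> * \<bar>g x\<bar> \<le> (norm (F k x) * K) * B"
      using K by (intro mult_mono) auto
    then show ?thesis
      by (simp add: abs_mult mult_ac)
  qed
  have int: "integrable (lebesgue_on S) (\<lambda>x. L (F k x) * g x)" for k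
  proof (rule Bochner_Integration.integrable_bound)
    show "integrable (lebesgue_on S) (\<lambda>x. K * B * norm (F k x))"
      using F'(1) by simp
    show "(\<lambda>x. L (F k x) * g x) \<in> borel_measurable (lebesgue_on S)"
      by (intro borel_measurable_times borel_measurable_integrable integrable_bounded_linear[OF L F'(1)] g)
    show "AE x in lebesgue_on S. norm (L (F k x) * g x) \<le> norm (K * B * norm (F k x))"
    proof (rule AE_I2)
      fix x assume "x \<in> space (lebesgue_on S)"
      from bound[OF this, of k] show "norm (L (F k x) * g x) \<le> norm (K * B * norm (F k x))"
        unfolding real_norm_def by linarith
    qed
  qed
  have "(\<lambda>k. LINT x|lebesgue_on S. L (F k x) * g x) sums (LINT x|lebesgue_on S. (\<Sum>k. L (F k x) * g x))"
  proof (rule sums_integral[OF int])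
    show "AE x in lebesgue_on S. summable (\<lambda>k. norm (L (F k x) * g x))"
      using F'(2) AE_space
    proof eventually_elim
      case (elim x)
      show ?case
        using bound[OF elim(2)]
        by (intro summable_comparison_test'[OF summable_mult[OF elim(1), of "K * B"], of 0]) simp
    qed
    show "summable (\<lambda>k. LINT x|lebesgue_on S. norm (L (F k x) * g x))"
    proof (rule summable_comparison_test'[OF summable_mult[OF F'(3), of "K * B"], of 0])
      fix k
      have "(LINT x|lebesgue_on S. norm (L (F k x) * g x)) \<le> (LINT x|lebesgue_on S. K * B * norm (F k x))"
        using int F'(1) bound by (intro integral_mono) auto
      then show "norm (LINT x|lebesgue_on S. norm (L (F k x) * g x)) \<le> K * B * (LINT x|lebesgue_on S. norm (F k x))"
        by simp
    qed
  qed
  also have "(LINT x|lebesgue_on S. (\<Sum>k. L (F k x) * g x)) = (LINT x|lebesgue_on S. L (\<Sum>k. F k x) * g x)"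
  proof (rule integral_cong_AE)
    show "(\<lambda>x. \<Sum>k. L (F k x) * g x) \<in> borel_measurable (lebesgue_on S)"
      using int by (intro borel_measurable_suminf) auto
    show "(\<lambda>x. L (\<Sum>k. F k x) * g x) \<in> borel_measurable (lebesgue_on S)"
      by (intro borel_measurable_times borel_measurable_integrable
          integrable_bounded_linear[OF L L1_series_integrable[OF F]] g)
    show "AE x in lebesgue_on S. (\<Sum>k. L (F k x) * g x) = L (\<Sum>k. F k x) * g x"
      using F'(2)
    proof eventually_elim
      case (elim x)
      then have "summable (\<lambda>k. F k x)"
        by (rule summable_norm_cancel)
      then have "(\<lambda>k. L (F k x) * g x) sums (L (\<Sum>k. F k x) * g x)"
        by (intro sums_mult2 L.sums summable_sums)
      then show ?case
        by (rule sums_unique[symmetric])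
    qed
  qed
  finally show ?thesis .
qed

text \<open>
  The partial sums converge uniformly together with their gradients, but the Hessians converge
  only in \<open>L\<^sup>1\<close>. One sequence \<open>a\<close> serves for all the bounds.
\<close>

locale superharmonic_series =
  fixes S :: "(real^'n) set" and f :: "nat \<Rightarrow> real^'n \<Rightarrow> real" and U H and a :: "nat \<Rightarrow> real"
  assumes S: "open S" "bounded S" "convex S"
    and gradient: "\<And>k. has_C1_gradient (f k) (U k)"
    and hessian: "\<And>k i. has_C1_gradient (\<lambda>z. U k z $ i) (\<lambda>z. H k z $ i)"
    and trace: "\<And>k z. (\<Sum>i\<in>UNIV. H k z $ i $ i) \<le> 0"
    and f_le: "\<And>k x. x \<in> S \<Longrightarrow> \<bar>f k x\<bar> \<le> a k"
    and U_le: "\<And>k x. x \<in> S \<Longrightarrow> norm (U k x) \<le> a k"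
    and H_le: "\<And>k. (LINT x|lebesgue_on S. norm (H k x)) \<le> a k"
    and a_summable: "summable a"
    and H_summable: "AE x in lebesgue_on S. summable (\<lambda>k. norm (H k x))"
begin

lemma cont: "continuous_on UNIV (f k)" "continuous_on UNIV (U k)" "continuous_on UNIV (H k)"
  using has_gradient_continuous[OF gradient]
    continuous_on_vec_lambda[of UNIV "\<lambda>i z. H k z $ i", OF has_gradient_continuous(2)[OF hessian]]
  by auto

lemma a_nonneg: "0 \<le> a k"
proof -
  have "0 \<le> (LINT x|lebesgue_on S. norm (H k x))"
    by simp
  then show ?thesis
    using H_le[of k] by linarith
qed

lemma bounded_L1_series:
  fixes F :: "nat \<Rightarrow> real^'n \<Rightarrow> 'b::euclidean_space"
  assumes F: "\<And>k. continuous_on UNIV (F k)" and le: "\<And>k x. x \<in> S \<Longrightarrow> norm (F k x) \<le> a k"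
  shows "L1_series S F"
  unfolding L1_series_def
proof (intro conjI allI)
  interpret finite_measure "lebesgue_on S"
    using S by (intro finite_measure_lebesgue_on_bounded)
  show int: "integrable (lebesgue_on S) (F k)" for k
    using S F by (intro continuous_integrable_lebesgue_on)
  show "AE x in lebesgue_on S. summable (\<lambda>k. norm (F k x))"
    using le by (intro AE_I2 summable_comparison_test'[OF a_summable, of 0]) auto
  show "summable (\<lambda>k. LINT x|lebesgue_on S. norm (F k x))"
  proof (rule summable_comparison_test'[OF summable_mult2[OF a_summable, of "measure (lebesgue_on S) (space (lebesgue_on S))"], of 0])
    fix k
    have "(LINT x|lebesgue_on S. norm (F k x)) \<le> (LINT x|lebesgue_on S. a k)"
      using int le by (intro integral_mono) auto
    then show "norm (LINT x|lebesgue_on S. norm (F k x)) \<le> a k * measure (lebesgue_on S) (space (lebesgue_on S))"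
      by (simp add: mult.commute)
  qed
qed

lemma L1_f: "L1_series S f" and L1_U: "L1_series S U"
  using cont f_le U_le by (auto intro: bounded_L1_series)

lemma L1_H: "L1_series S H"
  unfolding L1_series_def
proof (intro conjI allI H_summable)
  show "integrable (lebesgue_on S) (H k)" for k
    using S cont by (intro continuous_integrable_lebesgue_on)
  show "summable (\<lambda>k. LINT x|lebesgue_on S. norm (H k x))"
    using H_le by (intro summable_comparison_test'[OF a_summable, of 0]) simp
qed

definition u :: "real^'n \<Rightarrow> real" where "u x = (\<Sum>k. f k x)"
definition Du :: "real^'n \<Rightarrow> real^'n" where "Du x = (\<Sum>k. U k x)"
definition D2u :: "real^'n \<Rightarrow> real^'n^'n" where "D2u x = (\<Sum>k. H k x)"

lemma test_function_bounded:
  assumes "\<psi> \<in> test_functions S"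
  obtains B where "\<psi> \<in> borel_measurable (lebesgue_on S)" "\<And>x. x \<in> S \<Longrightarrow> \<bar>\<psi> x\<bar> \<le> B"
proof -
  have c: "continuous_on UNIV \<psi>"
    using has_gradient_continuous(1)[OF test_function_has_gradient[OF assms]] .
  show thesis
    using that continuous_measurable_lebesgue_on[OF c] continuous_bounded_on[OF c S(2)]
    by (metis real_norm_def)
qed

lemma integral_u_partial:
  assumes \<psi>: "\<psi> \<in> test_functions S"
  shows "(LINT x|lebesgue_on S. u x * partial i \<psi> x) = - (LINT x|lebesgue_on S. Du x $ i * \<psi> x)"
proof -
  obtain B where B: "\<psi> \<in> borel_measurable (lebesgue_on S)" "\<And>x. x \<in> S \<Longrightarrow> \<bar>\<psi> x\<bar> \<le> B"
    by (rule test_function_bounded[OF \<psi>], rule that)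
  obtain B' where B': "partial i \<psi> \<in> borel_measurable (lebesgue_on S)" "\<And>x. x \<in> S \<Longrightarrow> \<bar>partial i \<psi> x\<bar> \<le> B'"
    by (rule test_function_bounded[OF partial_test_function[OF \<psi>]], rule that)
  have lhs: "(\<lambda>k. LINT x|lebesgue_on S. f k x * partial i \<psi> x) sums (LINT x|lebesgue_on S. u x * partial i \<psi> x)"
    using L1_series_mult_sums[OF L1_f bounded_linear_ident B'] by (simp add: u_def)
  have rhs: "(\<lambda>k. - (LINT x|lebesgue_on S. U k x $ i * \<psi> x)) sums - (LINT x|lebesgue_on S. Du x $ i * \<psi> x)"
    using L1_series_mult_sums[OF L1_U bounded_linear_vec_nth B] by (intro sums_minus) (simp add: Du_def)
  have eq: "(LINT x|lebesgue_on S. f k x * partial i \<psi> x) = - (LINT x|lebesgue_on S. U k x $ i * \<psi> x)" for k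
    using S by (intro integral_by_parts_test_function[OF gradient \<psi>]) auto
  show ?thesis
    by (rule sums_unique2[OF lhs[unfolded eq] rhs])
qed

lemma integral_Du_partial:
  assumes \<psi>: "\<psi> \<in> test_functions S"
  shows "(LINT x|lebesgue_on S. Du x $ i * partial j \<psi> x) = - (LINT x|lebesgue_on S. D2u x $ i $ j * \<psi> x)"
proof -
  obtain B where B: "\<psi> \<in> borel_measurable (lebesgue_on S)" "\<And>x. x \<in> S \<Longrightarrow> \<bar>\<psi> x\<bar> \<le> B"
    by (rule test_function_bounded[OF \<psi>], rule that)
  obtain B' where B': "partial j \<psi> \<in> borel_measurable (lebesgue_on S)" "\<And>x. x \<in> S \<Longrightarrow> \<bar>partial j \<psi> x\<bar> \<le> B'"
    by (rule test_function_bounded[OF partial_test_function[OF \<psi>]], rule that)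
  have L: "bounded_linear (\<lambda>A::real^'n^'n. A $ i $ j)"
    using bounded_linear_compose[OF bounded_linear_vec_nth bounded_linear_vec_nth] .
  have lhs: "(\<lambda>k. LINT x|lebesgue_on S. U k x $ i * partial j \<psi> x) sums (LINT x|lebesgue_on S. Du x $ i * partial j \<psi> x)"
    using L1_series_mult_sums[OF L1_U bounded_linear_vec_nth B'] by (simp add: Du_def)
  have rhs: "(\<lambda>k. - (LINT x|lebesgue_on S. H k x $ i $ j * \<psi> x)) sums - (LINT x|lebesgue_on S. D2u x $ i $ j * \<psi> x)"
    using L1_series_mult_sums[OF L1_H L B] by (intro sums_minus) (simp add: D2u_def)
  have eq: "(LINT x|lebesgue_on S. U k x $ i * partial j \<psi> x) = - (LINT x|lebesgue_on S. H k x $ i $ j * \<psi> x)" for k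
    using S by (intro integral_by_parts_test_function[OF hessian \<psi>]) auto
  show ?thesis
    by (rule sums_unique2[OF lhs[unfolded eq] rhs])
qed

lemma integrable_u: "integrable (lebesgue_on S) u" "integrable (lebesgue_on S) Du" "integrable (lebesgue_on S) D2u"
  using L1_series_integrable[OF L1_f] L1_series_integrable[OF L1_U] L1_series_integrable[OF L1_H]
  by (simp_all add: u_def[abs_def] Du_def[abs_def] D2u_def[abs_def])

lemma weak_gradient_u: "has_weak_gradient S u Du"
  using S integrable_u integral_u_partial
  by (simp add: has_weak_gradient_def integrable_imp_locally_integrable)

lemma weak_hessian_u: "has_weak_hessian S u D2u"
proof -
  have "(LINT x|lebesgue_on S. u x * partial i (partial j \<psi>) x) = (LINT x|lebesgue_on S. D2u x $ i $ j * \<psi> x)"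
    if \<psi>: "\<psi> \<in> test_functions S" for \<psi> i j
    using integral_u_partial[OF partial_test_function[OF \<psi>]] integral_Du_partial[OF \<psi>] by simp
  then show ?thesis
    using S integrable_u by (simp add: has_weak_hessian_def integrable_imp_locally_integrable)
qed

lemma norm_suminf_le:
  fixes F :: "nat \<Rightarrow> 'b::euclidean_space"
  assumes "\<And>k. norm (F k) \<le> a k"
  shows "norm (\<Sum>k. F k) \<le> suminf a" "summable F"
proof -
  have s: "summable (\<lambda>k. norm (F k))"
    using assms by (intro summable_comparison_test'[OF a_summable, of 0]) auto
  then show "summable F"
    by (rule summable_norm_cancel)
  show "norm (\<Sum>k. F k) \<le> suminf a"
    using summable_norm[OF s] suminf_le[OF assms s a_summable] by linarith
qed

lemma Lp_u: "p \<ge> 0 \<Longrightarrow> u \<in> Lp_space p S" "p \<ge> 0 \<Longrightarrow> Du \<in> Lp_space p S"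
  using integrable_u norm_suminf_le(1)[of "\<lambda>k. f k x" for x] norm_suminf_le(1)[of "\<lambda>k. U k x" for x] f_le U_le
  by (auto intro!: bounded_Lp_space[OF S(1,2), where B="suminf a"] simp: u_def Du_def)

lemma D2u_Lp: "D2u \<in> Lp_space 1 S"
  using integrable_u(3) by (simp add: Lp_space_def)

lemma u_W2: "u \<in> W2 1 S"
  using Lp_u[of 1] D2u_Lp weak_gradient_u weak_hessian_u by (auto simp: W2_def W1_def)

text \<open>
  Each term has a bounded Laplacian and pairs nonnegatively with \<open>v\<close>, whereas the
  Laplacian of the sum is merely integrable. Summing the pairings, in which only the bounded
  gradients occur, avoids multiplying that Laplacian by \<open>v\<close>.
\<close>

lemma Du_pairing:
  assumes v: "v \<in> W1_0 2 S" "AE x in lebesgue_on S. 0 \<le> v x"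
    and V: "has_weak_gradient S v V" "V \<in> Lp_space 2 S"
  shows "0 \<le> (LINT x|lebesgue_on S. Du x \<bullet> V x)"
proof -
  have UL: "U k \<in> Lp_space 2 S" for k
    using S cont by (intro continuous_Lp_space) auto
  have int: "integrable (lebesgue_on S) (\<lambda>x. U k x \<bullet> V x)" for k
    by (rule Lp_space_2_inner_integrable[OF UL V(2)])
  have intV: "integrable (lebesgue_on S) (\<lambda>x. norm (V x))"
  proof (rule Bochner_Integration.integrable_bound[of _ "\<lambda>x. 1 + (norm (V x))\<^sup>2"])
    interpret finite_measure "lebesgue_on S"
      using S by (intro finite_measure_lebesgue_on_bounded)
    show "integrable (lebesgue_on S) (\<lambda>x. 1 + (norm (V x))\<^sup>2)"
      using V(2) by (simp add: Lp_space_2_iff)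
    have "t \<le> 1 + t\<^sup>2" for t :: real
      using zero_le_power2[of "t - 1 / 2"] by (simp add: power2_eq_square algebra_simps)
    then show "AE x in lebesgue_on S. norm (norm (V x)) \<le> norm (1 + (norm (V x))\<^sup>2)"
      by (intro AE_I2) simp
  qed (use V(2) in \<open>auto simp: Lp_space_2_iff\<close>)
  have le: "\<bar>U k x \<bullet> V x\<bar> \<le> a k * norm (V x)" if "x \<in> S" for k x
    using Cauchy_Schwarz_ineq2[of "U k x" "V x"] mult_right_mono[OF U_le[OF that, of k], of "norm (V x)"]
    by simp
  have "(\<lambda>k. LINT x|lebesgue_on S. U k x \<bullet> V x) sums (LINT x|lebesgue_on S. (\<Sum>k. U k x \<bullet> V x))"
  proof (rule sums_integral[OF int])
    show "AE x in lebesgue_on S. summable (\<lambda>k. norm (U k x \<bullet> V x))"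
      using le by (intro AE_I2 summable_comparison_test'[OF summable_mult2[OF a_summable], of 0]) auto
    show "summable (\<lambda>k. LINT x|lebesgue_on S. norm (U k x \<bullet> V x))"
    proof (rule summable_comparison_test'[OF summable_mult2[OF a_summable, of "LINT x|lebesgue_on S. norm (V x)"], of 0])
      fix k
      have "(LINT x|lebesgue_on S. norm (U k x \<bullet> V x)) \<le> (LINT x|lebesgue_on S. a k * norm (V x))"
        using int intV le by (intro integral_mono) auto
      then show "norm (LINT x|lebesgue_on S. norm (U k x \<bullet> V x)) \<le> a k * (LINT x|lebesgue_on S. norm (V x))"
        by simp
    qed
  qed
  also have "(LINT x|lebesgue_on S. (\<Sum>k. U k x \<bullet> V x)) = (LINT x|lebesgue_on S. Du x \<bullet> V x)"
  proof (rule Bochner_Integration.integral_cong[OF refl])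
    fix x assume "x \<in> space (lebesgue_on S)"
    then have "summable (\<lambda>k. U k x)"
      using U_le norm_suminf_le(2)[of "\<lambda>k. U k x"] by simp
    then show "(\<Sum>k. U k x \<bullet> V x) = Du x \<bullet> V x"
      unfolding Du_def by (intro sums_unique[symmetric] bounded_linear.sums[OF bounded_linear_inner_left] summable_sums)
  qed
  finally have pairing: "(\<lambda>k. LINT x|lebesgue_on S. U k x \<bullet> V x) sums (LINT x|lebesgue_on S. Du x \<bullet> V x)" .
  show ?thesis
    by (rule sums_le[OF _ sums_zero pairing]) (rule superharmonic_pairing_nonneg[OF S(1,2) hessian trace v V])
qed

lemma u_obstacle_solution: "obstacle_solution S u u u"
  using Lp_u[of 2] weak_gradient_u Du_pairing S by (intro obstacle_solution_self) auto

lemma u_lipschitz: "(suminf a)-lipschitz_on S u"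
proof (rule lipschitz_onI)
  show "0 \<le> suminf a"
    using a_summable a_nonneg by (rule suminf_nonneg)
  fix x y assume xy: "x \<in> S" "y \<in> S"
  have le: "norm (f k x - f k y) \<le> a k * norm (x - y)" for k
  proof (rule differentiable_bound[OF S(3) _ _ xy])
    show "(f k has_derivative (\<lambda>h. U k z \<bullet> h)) (at z within S)" for z
      using gradient by (auto simp: has_C1_gradient_def intro: has_derivative_at_withinI)
    show "onorm (\<lambda>h. U k z \<bullet> h) \<le> a k" if "z \<in> S" for z
    proof (rule onorm_bound[OF a_nonneg])
      show "norm (U k z \<bullet> h) \<le> a k * norm h" for h
        using Cauchy_Schwarz_ineq2[of "U k z" h] mult_right_mono[OF U_le[OF that, of k], of "norm h"] by simp
    qed
  qed
  have s: "summable (\<lambda>k. f k x)" if "x \<in> S" for x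
    using norm_suminf_le(2)[of "\<lambda>k. f k x"] f_le[OF that] by simp
  have sn: "summable (\<lambda>k. norm (f k x - f k y))"
    using le by (intro summable_comparison_test'[OF summable_mult2[OF a_summable], of 0]) auto
  have "dist (u x) (u y) = norm (\<Sum>k. f k x - f k y)"
    using suminf_diff[OF s[OF xy(1)] s[OF xy(2)]] by (simp add: u_def dist_norm)
  also have "\<dots> \<le> (\<Sum>k. norm (f k x - f k y))"
    by (rule summable_norm[OF sn])
  also have "\<dots> \<le> (\<Sum>k. a k * norm (x - y))"
    by (rule suminf_le[OF le sn summable_mult2[OF a_summable]])
  also have "\<dots> = suminf a * dist x y"
    using suminf_mult2[OF a_summable] by (simp add: dist_norm)
  finally show "dist (u x) (u y) \<le> suminf a * dist x y" .
qed

end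

section \<open>Scales, amplitudes and the positive part\<close>

lemma has_gradient_cmult:
  assumes "has_C1_gradient f V"
  shows "has_C1_gradient (\<lambda>z. c * f z) (\<lambda>z. c *\<^sub>R V z)"
  using assms unfolding has_C1_gradient_def inner_scaleR_left
  by (auto intro!: has_derivative_mult_right continuous_on_scaleR continuous_on_const)

text \<open>
  The radii decrease so fast that the amplitude \<open>weight k / radius k\<close> of the second
  derivatives at scale \<open>k\<close> dominates the sum of all coarser ones, and that
  \<open>(weight k / radius k) powr p * radius k\<close> tends to infinity for every \<open>p > 1\<close>. For \<open>p = 1\<close> this
  quantity is \<open>weight k\<close>, which is summable.
\<close>

definition radius :: "nat \<Rightarrow> real" where "radius k = (1 / 8) ^ (k\<^sup>2)"
definition weight :: "nat \<Rightarrow> real" where "weight k = (1 / 2) ^ k"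

lemma radius_bounds: "0 < radius k" "radius k \<le> 1"
  by (auto simp: radius_def intro!: power_le_one)

lemma radius_antimono: "m \<le> k \<Longrightarrow> radius k \<le> radius m"
  unfolding radius_def by (intro power_decreasing) auto

lemma radius_Suc: "radius (Suc k) = (1 / 8) ^ (2 * k + 1) * radius k"
proof -
  have "(Suc k)\<^sup>2 = (2 * k + 1) + k\<^sup>2"
    by (simp add: power2_eq_square)
  then show ?thesis
    unfolding radius_def by (simp only: power_add)
qed

lemma radius_Suc_le: "8 * radius (Suc k) \<le> radius k"
proof -
  have "(1 / 8 :: real) ^ (2 * k + 1) \<le> (1 / 8) ^ 1"
    by (intro power_decreasing) auto
  then have "radius (Suc k) \<le> (1 / 8) * radius k"
    unfolding radius_Suc using radius_bounds(1)[of k] by (intro mult_right_mono) auto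
  then show ?thesis
    by simp
qed

lemma weight_pos: "0 < weight k"
  by (simp add: weight_def)

lemma weight_summable: "summable weight"
  unfolding weight_def[abs_def] by (rule summable_geometric) simp

lemma amplitude_Suc: "4 * (weight k / radius k) \<le> weight (Suc k) / radius (Suc k)"
proof -
  have "8 * radius (Suc k) * weight k \<le> radius k * weight k"
    using radius_Suc_le[of k] weight_pos[of k] by (intro mult_right_mono) auto
  then show ?thesis
    using radius_bounds(1)[of k] radius_bounds(1)[of "Suc k"] by (simp add: weight_def field_simps)
qed

lemma amplitude_sum_le: "3 * (\<Sum>m<k. weight m / radius m) \<le> weight k / radius k"
proof (induction k)
  case 0
  then show ?case
    using radius_bounds(1)[of 0] weight_pos[of 0] by simp
next
  case (Suc k)
  then show ?case
    using amplitude_Suc[of k] by simp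
qed

lemma amplitude_powr_at_top:
  assumes "p > 1"
  shows "filterlim (\<lambda>k. (weight k / radius k) powr p * radius k) at_top sequentially"
proof -
  have "(weight k / radius k) powr p * radius k =
      2 powr (p * (3 * (real k)\<^sup>2 - real k) - 3 * (real k)\<^sup>2)" for k
  proof -
    have s: "radius k = 2 powr (- 3 * (real k)\<^sup>2)"
    proof -
      have "radius k = (1 / 8) powr real (k\<^sup>2)"
        unfolding radius_def by (rule powr_realpow[symmetric]) simp
      also have "(1 / 8 :: real) = 2 powr (- 3)"
        by (simp add: powr_neg_numeral)
      finally show ?thesis
        by (simp add: powr_powr)
    qed
    have w: "weight k = 2 powr (- real k)"
      by (simp add: weight_def powr_minus powr_realpow power_one_over inverse_eq_divide)
    have "weight k / radius k = 2 powr (3 * (real k)\<^sup>2 - real k)"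
      unfolding s w by (simp flip: powr_diff)
    then show ?thesis
      by (simp add: s powr_powr mult.commute flip: powr_add)
  qed
  moreover have "filterlim (\<lambda>k. 2 powr (p * (3 * (real k)\<^sup>2 - real k) - 3 * (real k)\<^sup>2)) at_top sequentially"
    using assms by real_asymp
  ultimately show ?thesis
    by simp
qed

lemma matrix_pos_part_diagonal:
  fixes A :: "real^'n^'n"
  assumes "\<And>a b. a \<noteq> b \<Longrightarrow> A $ a $ b = 0"
  shows "matrix_pos_part A = diag_matrix (\<chi> a. max 0 (A $ a $ a))"
proof -
  have "A = mat 1 ** diag_matrix (\<chi> a. A $ a $ a) ** transpose (mat 1)"
    using assms by (simp add: transpose_mat vec_eq_iff diag_matrix_def)
  then have "matrix_pos_part A =
      mat 1 ** diag_matrix (\<chi> a. max 0 ((\<chi> a. A $ a $ a) $ a)) ** transpose (mat 1)"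
    using matrix_pos_part_diagonalisation[of "mat 1" "\<chi> a. A $ a $ a"]
    by (simp add: orthogonal_matrix_id)
  then show ?thesis
    by (simp add: transpose_mat)
qed

lemma norm_matrix_pos_part_ge:
  fixes A :: "real^'n^'n"
  assumes "\<And>a b. a \<noteq> b \<Longrightarrow> A $ a $ b = 0"
  shows "A $ a $ a \<le> norm (matrix_pos_part A)"
proof -
  have "A $ a $ a \<le> \<bar>matrix_pos_part A $ a $ a\<bar>"
    by (simp add: matrix_pos_part_diagonal[OF assms] diag_matrix_def)
  also have "\<dots> \<le> norm (matrix_pos_part A $ a)"
    by (rule component_le_norm_cart)
  also have "\<dots> \<le> norm (matrix_pos_part A)"
    by (rule Finite_Cartesian_Product.norm_nth_le)
  finally show ?thesis .
qed

text \<open>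
  One of \<open>\<plusminus> cos \<theta>\<close> and \<open>\<plusminus> sin \<theta>\<close> is at least \<open>1 / 2\<close>, because their squares add up to 1.
\<close>

lemma cos_quarter_turn: "\<exists>m<4::nat. 1 / 2 \<le> cos (\<theta> - real m * (pi / 2))"
proof -
  have "\<bar>cos \<theta>\<bar> \<ge> 1 / 2 \<or> \<bar>sin \<theta>\<bar> \<ge> 1 / 2"
  proof (rule ccontr)
    assume "\<not> ?thesis"
    then have "\<bar>cos \<theta>\<bar>\<^sup>2 \<le> (1 / 2)\<^sup>2" "\<bar>sin \<theta>\<bar>\<^sup>2 \<le> (1 / 2)\<^sup>2"
      by (intro power_mono; linarith)+
    then show False
      using sin_cos_squared_add[of \<theta>] by (simp add: power2_eq_square)
  qed
  then consider "1 / 2 \<le> cos \<theta>" | "1 / 2 \<le> - cos \<theta>" | "1 / 2 \<le> sin \<theta>" | "1 / 2 \<le> - sin \<theta>"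
    by linarith
  then show ?thesis
  proof cases
    case 1
    then show ?thesis
      by (intro exI[of _ 0]) simp
  next
    case 2
    then show ?thesis
      by (intro exI[of _ 2]) (simp add: cos_diff)
  next
    case 3
    then show ?thesis
      by (intro exI[of _ 1]) (simp add: cos_diff)
  next
    case 4
    have "cos (\<theta> - 3 * (pi / 2)) = - sin \<theta>"
      using cos_diff[of \<theta> "3 * (pi / 2)"] cos_3over2_pi sin_3over2_pi by simp
    then show ?thesis
      using 4 by (intro exI[of _ 3]) simp
  qed
qed

text \<open>
  Four translates of the set \<open>E\<close>, by multiples of a quarter period in the direction \<open>j\<close>, cover a
  box. Hence \<open>E\<close> has at least a quarter of the volume of that box; the bound on \<open>r\<close> ensures that the
  translates stay within the range allowed for the coordinate \<open>j\<close>.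
\<close>

lemma cosine_set_measure:
  fixes i j :: "'n::finite" and \<delta> r :: real
  assumes ij: "i \<noteq> j" and r: "r > 0" "3 * (pi / 2) * r \<le> \<delta> / 2"
    and E_def: "E = {z :: real^'n. (\<forall>l. (if l = i then r / 2 else 0) \<le> z $ l \<and>
      z $ l \<le> (if l = i then 3 * r / 4 else \<delta>)) \<and> 1 / 2 \<le> cos (z $ j / r)}"
  shows "E \<in> lmeasurable" "r / 4 * (\<delta> / 2) ^ (CARD('n) - 1) \<le> 4 * measure lebesgue E"
proof -
  have "0 < 3 * (pi / 2) * r"
    using r(1) by simp
  then have \<delta>: "\<delta> > 0"
    using r(2) by linarith
  (* The box from lo' leaves room of size delta / 2 below it for the backward shifts. *)
  define lo hi lo' where "lo = (\<chi> l. if l = i then r / 2 else 0)"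
    and "hi = (\<chi> l. if l = i then 3 * r / 4 else \<delta>)"
    and "lo' = (\<chi> l. if l = i then r / 2 else \<delta> / 2)"
  have E: "E = cbox lo hi \<inter> {z. 1 / 2 \<le> cos (z $ j / r)}"
    by (simp add: E_def set_eq_iff mem_box_cart lo_def hi_def)
  have "closed {z :: real^'n. 1 / 2 \<le> cos (z $ j / r)}"
    using r by (intro closed_Collect_le continuous_intros) auto
  then have "compact E"
    unfolding E by (intro compact_Int_closed compact_cbox)
  then show Em: "E \<in> lmeasurable"
    by (rule lmeasurable_compact)
  define shift where "shift m = (+) ((real m * (pi / 2 * r)) *\<^sub>R axis j (1::real))" for m :: nat
  have "cbox lo' hi \<subseteq> (\<Union>m<4. shift m ` E)"
  proof
    fix z assume z: "z \<in> cbox lo' hi"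
    obtain m :: nat where m: "m < 4" "1 / 2 \<le> cos (z $ j / r - real m * (pi / 2))"
      using cos_quarter_turn by blast
    define y where "y = z - (real m * (pi / 2 * r)) *\<^sub>R axis j 1"
    have y: "y $ l = (if l = j then z $ j - real m * (pi / 2 * r) else z $ l)" for l
      by (simp add: y_def axis_def)
    have "real m * (pi / 2 * r) \<le> 3 * (pi / 2 * r)"
      using m(1) r by (intro mult_right_mono) auto
    moreover have "3 * (pi / 2 * r) \<le> \<delta> / 2"
      using r(2) by (simp only: mult.assoc)
    ultimately have "real m * (pi / 2 * r) \<le> \<delta> / 2"
      by (rule order_trans)
    moreover have "0 \<le> real m * (pi / 2 * r)"
      using r(1) by simp
    ultimately have "lo $ l \<le> y $ l \<and> y $ l \<le> hi $ l" for l
      using z[unfolded mem_box_cart, rule_format, of l] ij \<delta> unfolding y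
      by (auto simp: lo_def lo'_def hi_def)
    moreover have "y $ j / r = z $ j / r - real m * (pi / 2)"
      using r by (simp add: y diff_divide_distrib)
    ultimately have "y \<in> E"
      using m(2) by (simp add: E mem_box_cart)
    then have "z \<in> shift m ` E"
      by (intro image_eqI[of _ _ y]) (simp_all add: shift_def y_def)
    then show "z \<in> (\<Union>m<4. shift m ` E)"
      using m(1) by blast
  qed
  then have "measure lebesgue (cbox lo' hi) \<le> measure lebesgue (\<Union>m<4. shift m ` E)"
    using Em by (intro measure_mono_fmeasurable) (auto simp: shift_def intro!: fmeasurable.finite_UN measurable_translation)
  also have "\<dots> \<le> (\<Sum>m<4. measure lebesgue (shift m ` E))"
    using Em by (intro measure_UNION_le) (auto simp: shift_def intro!: fmeasurableD measurable_translation)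
  also have "\<dots> = 4 * measure lebesgue E"
    by (simp add: shift_def measure_translation)
  finally have "measure lebesgue (cbox lo' hi) \<le> 4 * measure lebesgue E" .
  moreover have "measure lebesgue (cbox lo' hi) = r / 4 * (\<delta> / 2) ^ (CARD('n) - 1)"
  proof -
    have "lo' \<in> cbox lo' hi"
      using r \<delta> by (auto simp: mem_box_cart lo'_def hi_def)
    then have "measure lebesgue (cbox lo' hi) = (\<Prod>l\<in>UNIV. hi $ l - lo' $ l)"
      using content_cbox_cart[of lo' hi] by auto
    also have "\<dots> = (hi $ i - lo' $ i) * (\<Prod>l\<in>UNIV - {i}. hi $ l - lo' $ l)"
      by (rule prod.remove) auto
    also have "(\<Prod>l\<in>UNIV - {i}. hi $ l - lo' $ l) = (\<Prod>l\<in>UNIV - {i}. \<delta> / 2)"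
      by (rule prod.cong) (auto simp: lo'_def hi_def)
    also have "\<dots> = (\<delta> / 2) ^ (CARD('n) - 1)"
      by (simp add: card_Diff_singleton)
    finally show ?thesis
      by (simp add: lo'_def hi_def)
  qed
  ultimately show "r / 4 * (\<delta> / 2) ^ (CARD('n) - 1) \<le> 4 * measure lebesgue E"
    by simp
qed

section \<open>The example\<close>

locale wave_series = wave w w' w'' M i j for w w' w'' M and i j :: "'n::finite" +
  fixes C :: real
  assumes C: "\<And>r. r > 0 \<Longrightarrow> (LINT z|lebesgue_on (ball (0::real^'n) 1). soft_abs2 r (z $ i)) \<le> C"
begin

lemma norm_weighted_layer_hess:
  "norm (weight k *\<^sub>R layer_hess (radius k) z) \<le> weight k * (5 * M * soft_abs2 (radius k) (z $ i))"
  using layer_hess_bound[OF radius_bounds(1), of k z] weight_pos[of k] by (simp add: mult_left_mono)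

lemma summable_hess:
  assumes "z $ i \<noteq> 0"
  shows "summable (\<lambda>k. norm (weight k *\<^sub>R layer_hess (radius k) z))"
proof (rule summable_comparison_test'[OF summable_mult2[OF weight_summable, of "5 * M * (1 / \<bar>z $ i\<bar> ^ 3)"], of 0])
  fix k
  have "(radius k)\<^sup>2 \<le> 1"
    using radius_bounds[of k] by (intro power_le_one) auto
  then have "(radius k)\<^sup>2 / \<bar>z $ i\<bar> ^ 3 \<le> 1 / \<bar>z $ i\<bar> ^ 3"
    by (intro divide_right_mono) auto
  then have "soft_abs2 (radius k) (z $ i) \<le> 1 / \<bar>z $ i\<bar> ^ 3"
    using soft_abs2_le[OF assms, of "radius k"] by linarith
  then have "5 * M * soft_abs2 (radius k) (z $ i) \<le> 5 * M * (1 / \<bar>z $ i\<bar> ^ 3)"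
    using M_pos by (intro mult_left_mono) auto
  then have "weight k * (5 * M * soft_abs2 (radius k) (z $ i)) \<le> weight k * (5 * M * (1 / \<bar>z $ i\<bar> ^ 3))"
    by (rule mult_left_mono) (simp add: weight_pos less_imp_le)
  then show "norm (norm (weight k *\<^sub>R layer_hess (radius k) z)) \<le> weight k * (5 * M * (1 / \<bar>z $ i\<bar> ^ 3))"
    using norm_weighted_layer_hess[of k z] by simp
qed

lemma AE_off_hyperplane: "AE z in lebesgue_on (ball (0::real^'n) 1). z $ i \<noteq> 0"
proof -
  have "negligible {z::real^'n. z $ i = 0}"
    by (rule negligible_standard_hyperplane_cart)
  then have "AE z in lebesgue. z \<notin> {z::real^'n. z $ i = 0}"
    unfolding negligible_iff_null_sets by (rule AE_not_in)
  then show ?thesis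
    by (simp add: AE_restrict_space_iff) (auto elim: eventually_mono)
qed

sublocale series: superharmonic_series "ball (0::real^'n) 1" "\<lambda>k z. weight k * layer (radius k) z"
  "\<lambda>k z. weight k *\<^sub>R layer_grad (radius k) z" "\<lambda>k z. weight k *\<^sub>R layer_hess (radius k) z"
  "\<lambda>k. weight k * (3 * M + 5 * M * \<bar>C\<bar>)"
proof
  have w: "weight k * t \<le> weight k * (3 * M + 5 * M * \<bar>C\<bar>)" if "t \<le> 3 * M" for k t
    using that weight_pos[of k] M_pos by (intro mult_left_mono) (auto intro: add_increasing2)
  show "open (ball (0::real^'n) 1)" "bounded (ball (0::real^'n) 1)" "convex (ball (0::real^'n) 1)"
    by auto
  show "has_C1_gradient (\<lambda>z. weight k * layer (radius k) z) (\<lambda>z. weight k *\<^sub>R layer_grad (radius k) z)" for k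
    by (intro has_gradient_cmult layer_has_gradient radius_bounds)
  show "has_C1_gradient (\<lambda>z. (weight k *\<^sub>R layer_grad (radius k) z) $ l)
      (\<lambda>z. (weight k *\<^sub>R layer_hess (radius k) z) $ l)" for k l
    using has_gradient_cmult[OF layer_grad_has_gradient[OF radius_bounds(1)]] by simp
  show "(\<Sum>l\<in>UNIV. (weight k *\<^sub>R layer_hess (radius k) z) $ l $ l) \<le> 0" for k z
  proof -
    have "(\<Sum>l\<in>UNIV. (weight k *\<^sub>R layer_hess (radius k) z) $ l $ l) =
        weight k * (\<Sum>l\<in>UNIV. layer_hess (radius k) z $ l $ l)"
      by (simp add: sum_distrib_left)
    then show ?thesis
      using layer_superharmonic[OF radius_bounds(1), of k z] weight_pos[of k]
      by (simp add: mult_nonneg_nonpos)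
  qed
  show "\<bar>weight k * layer (radius k) z\<bar> \<le> weight k * (3 * M + 5 * M * \<bar>C\<bar>)" if "z \<in> ball 0 1" for k z
    using w[OF layer_bound[OF radius_bounds that]] weight_pos[of k] by (simp add: abs_mult)
  show "norm (weight k *\<^sub>R layer_grad (radius k) z) \<le> weight k * (3 * M + 5 * M * \<bar>C\<bar>)" for k z
    using w[OF layer_grad_bound] weight_pos[of k] by simp
  show "(LINT z|lebesgue_on (ball 0 1). norm (weight k *\<^sub>R layer_hess (radius k) z))
      \<le> weight k * (3 * M + 5 * M * \<bar>C\<bar>)" for k
  proof -
    have c: "continuous_on UNIV (\<lambda>z::real^'n. soft_abs2 (radius k) (z $ i))"
      by (intro continuous_on_compose2[OF soft_abs2_continuous[OF radius_bounds(1), of UNIV]] continuous_intros) auto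
    have "continuous_on UNIV (layer_hess (radius k))"
      using continuous_on_vec_lambda[of UNIV "\<lambda>l z. layer_hess (radius k) z $ l",
          OF has_gradient_continuous(2)[OF layer_grad_has_gradient[OF radius_bounds(1)]]] by simp
    then have "(LINT z|lebesgue_on (ball 0 1). norm (weight k *\<^sub>R layer_hess (radius k) z)) \<le>
        (LINT z|lebesgue_on (ball 0 1). weight k * (5 * M * soft_abs2 (radius k) (z $ i)))"
      using c norm_weighted_layer_hess
      by (intro integral_mono continuous_integrable_lebesgue_on continuous_intros) auto
    also have "\<dots> = weight k * (5 * M * (LINT z|lebesgue_on (ball (0::real^'n) 1). soft_abs2 (radius k) (z $ i)))"
      by simp
    also have "\<dots> \<le> weight k * (3 * M + 5 * M * \<bar>C\<bar>)"
    proof (intro mult_left_mono)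
      have "5 * M * (LINT z|lebesgue_on (ball (0::real^'n) 1). soft_abs2 (radius k) (z $ i)) \<le> 5 * M * \<bar>C\<bar>"
        using C[OF radius_bounds(1), of k] M_pos by (intro mult_left_mono) auto
      then show "5 * M * (LINT z|lebesgue_on (ball (0::real^'n) 1). soft_abs2 (radius k) (z $ i)) \<le> 3 * M + 5 * M * \<bar>C\<bar>"
        using M_pos by linarith
    qed (use weight_pos[of k] in simp)
    finally show ?thesis .
  qed
  show "summable (\<lambda>k. weight k * (3 * M + 5 * M * \<bar>C\<bar>))"
    by (rule summable_mult2[OF weight_summable])
  show "AE z in lebesgue_on (ball 0 1). summable (\<lambda>k. norm (weight k *\<^sub>R layer_hess (radius k) z))"
    using AE_off_hyperplane by eventually_elim (rule summable_hess)
qed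

lemma D2u_sums:
  assumes "z $ i \<noteq> 0"
  shows "(\<lambda>k. weight k * layer_hess (radius k) z $ a $ b) sums (series.D2u z $ a $ b)"
proof -
  have "(\<lambda>k. weight k *\<^sub>R layer_hess (radius k) z) sums series.D2u z"
    unfolding series.D2u_def using summable_norm_cancel[OF summable_hess[OF assms]] by (rule summable_sums)
  from bounded_linear.sums[OF bounded_linear_compose[OF bounded_linear_vec_nth bounded_linear_vec_nth] this, of a b]
  show ?thesis
    by simp
qed

context
  fixes k :: nat and z :: "real^'n"
  assumes z: "2 * radius (Suc k) < z $ i" "z $ i < radius k"
begin

lemma z_pos: "z $ i > 0"
  using z(1) radius_bounds(1)[of "Suc k"] by linarith

lemma cutoff_argument_coarse: "m \<le> k \<Longrightarrow> \<bar>z $ i / radius m\<bar> < 1"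
  using radius_antimono[of m k] z(2) z_pos radius_bounds(1)[of m] by (simp add: abs_divide divide_less_eq_1_pos)

lemma cutoff_argument_fine: "k < m \<Longrightarrow> 2 < \<bar>z $ i / radius m\<bar>"
  using radius_antimono[of "Suc k" m] z(1) z_pos radius_bounds(1)[of m] by (simp add: abs_divide less_divide_eq)

lemma layer_xy_eq_0: "layer_xy (radius m) z = 0"
  using cutoff_argument_coarse[of m] cutoff_argument_fine[of m] w_inner(2) w_outer(2) by (cases "m \<le> k") (auto simp: layer_xy_def not_le)

text \<open>
  In the slab between two consecutive scales the Hessian is diagonal: every coarser layer has a
  constant cutoff there, and every finer layer does not oscillate. This makes its positive part
  explicit.
\<close>

lemma D2u_diagonal:
  assumes "a \<noteq> b"
  shows "series.D2u z $ a $ b = 0"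
proof -
  have "layer_hess (radius m) z $ a $ b = 0" for m
    using assms by (auto simp: layer_hess_nth layer_xy_eq_0 axis_def)
  then have "(\<lambda>m. 0) sums (series.D2u z $ a $ b)"
    using D2u_sums[of z a b] z_pos by simp
  then show ?thesis
    by (rule sums_unique2[OF _ sums_zero])
qed

lemma D2u_yy:
  "series.D2u z $ j $ j = (\<Sum>m\<le>k. weight m / radius m * cos (z $ j / radius m))"
proof -
  have yy: "layer_hess (radius m) z $ j $ j = layer_yy (radius m) z" for m
    using ij by (simp add: layer_hess_nth axis_def)
  have "(\<lambda>m. weight m * layer_hess (radius m) z $ j $ j) sums (\<Sum>m\<le>k. weight m * layer_hess (radius m) z $ j $ j)"
    using cutoff_argument_fine w_outer(1) by (intro sums_finite) (auto simp: yy layer_yy_def)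
  moreover have "z $ i \<noteq> 0"
    using z_pos by simp
  ultimately have "series.D2u z $ j $ j = (\<Sum>m\<le>k. weight m * layer_hess (radius m) z $ j $ j)"
    by (intro sums_unique2[OF D2u_sums])
  also have "\<dots> = (\<Sum>m\<le>k. weight m / radius m * cos (z $ j / radius m))"
    using cutoff_argument_coarse w_inner(1) by (intro sum.cong) (auto simp: yy layer_yy_def)
  finally show ?thesis .
qed

text \<open>
  Only the layers up to \<open>k\<close> contribute to the second derivative in \<open>y\<close>. Layer \<open>k\<close>
  gives at least half its amplitude, and the coarser ones together can cancel at most a third of that amplitude.
\<close>

lemma norm_pos_part_ge:
  assumes "1 / 2 \<le> cos (z $ j / radius k)"
  shows "weight k / radius k / 6 \<le> norm (matrix_pos_part (series.D2u z))"
proof -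
  define b where "b m = weight m / radius m" for m
  have b: "0 < b m" for m
    using weight_pos radius_bounds(1) by (simp add: b_def)
  have "- (\<Sum>m<k. b m) \<le> (\<Sum>m<k. b m * cos (z $ j / radius m))"
    unfolding sum_negf[symmetric]
  proof (rule sum_mono)
    show "- b m \<le> b m * cos (z $ j / radius m)" for m
      using mult_left_mono[OF cos_ge_minus_one[of "z $ j / radius m"], of "b m"] b[of m] by simp
  qed
  moreover have "b k * (1 / 2) \<le> b k * cos (z $ j / radius k)"
    using assms b[of k] by (intro mult_left_mono) auto
  moreover have "3 * (\<Sum>m<k. b m) \<le> b k"
    unfolding b_def by (rule amplitude_sum_le)
  moreover have "series.D2u z $ j $ j = (\<Sum>m<k. b m * cos (z $ j / radius m)) + b k * cos (z $ j / radius k)"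
    unfolding D2u_yy b_def[symmetric] by (simp flip: lessThan_Suc_atMost)
  ultimately have "b k / 6 \<le> series.D2u z $ j $ j"
    by linarith
  also have "\<dots> \<le> norm (matrix_pos_part (series.D2u z))"
    using D2u_diagonal by (rule norm_matrix_pos_part_ge)
  finally show ?thesis
    by (simp add: b_def)
qed

end

text \<open>
  On a subset of slab \<open>k\<close> with volume of order \<open>radius k\<close> the positive part is of order
  \<open>weight k / radius k\<close>. The contributions of single slabs to the \<open>p\<close>-th power integral are
  therefore already unbounded.
\<close>

lemma pos_part_not_Lp:
  assumes p: "p > 1"
  shows "(\<lambda>z. matrix_pos_part (weak_hessian (ball 0 1) series.u z)) \<notin> Lp_space p (ball 0 1)"
proof
  let ?B = "ball (0::real^'n) 1"
  let ?F = "\<lambda>z. norm (matrix_pos_part (weak_hessian ?B series.u z)) powr p"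
  assume "(\<lambda>z. matrix_pos_part (weak_hessian ?B series.u z)) \<in> Lp_space p ?B"
  then have int: "integrable (lebesgue_on ?B) ?F"
    by (simp add: Lp_space_def)
  (* With this side length the l1 norm, hence the Euclidean norm, is below 1 on the sets E. *)
  define \<delta> where "\<delta> = 1 / (2 * real CARD('n))"
  have \<delta>: "\<delta> > 0"
    by (simp add: \<delta>_def)
  define K where "K = (\<delta> / 2) ^ (CARD('n) - 1) / 16"
  have K: "K > 0"
    using \<delta> by (simp add: K_def)
  define b where "b k = weight k / radius k" for k
  have b: "0 < b k" for k
    using weight_pos radius_bounds(1) by (simp add: b_def)
  have bound: "(b k / 6) powr p * (radius k * K) \<le> integral\<^sup>L (lebesgue_on ?B) ?F"
    if k: "k \<ge> 1" "3 * (pi / 2) * radius k \<le> \<delta> / 2" for k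
  proof -
    define r where "r = radius k"
    define E where "E = {z :: real^'n. (\<forall>l. (if l = i then r / 2 else 0) \<le> z $ l \<and>
      z $ l \<le> (if l = i then 3 * r / 4 else \<delta>)) \<and> 1 / 2 \<le> cos (z $ j / r)}"
    have r: "r > 0" "r \<le> 1 / 8"
    proof -
      show "r > 0"
        by (simp add: r_def radius_bounds)
      have "radius k \<le> radius 1"
        by (rule radius_antimono[OF k(1)])
      then show "r \<le> 1 / 8"
        by (simp add: r_def radius_def)
    qed
    have E: "E \<in> lmeasurable" "r / 4 * (\<delta> / 2) ^ (CARD('n) - 1) \<le> 4 * measure lebesgue E"
      using cosine_set_measure[OF ij r(1) k(2)[folded r_def] E_def] by auto
    (* The first coordinate contributes at most 3 r / 4, and all coordinates together at most 1/2 more. *)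
    have sub: "E \<subseteq> ?B"
    proof
      fix z assume z: "z \<in> E"
      have "norm z \<le> (\<Sum>l\<in>UNIV. \<bar>z $ l\<bar>)"
        by (rule norm_le_l1_cart)
      also have "\<dots> \<le> (\<Sum>l\<in>UNIV. (if l = i then 3 * r / 4 else 0) + \<delta>)"
      proof (rule sum_mono)
        fix l
        have "(if l = i then r / 2 else 0) \<le> z $ l \<and> z $ l \<le> (if l = i then 3 * r / 4 else \<delta>)"
          using z by (simp add: E_def)
        then show "\<bar>z $ l\<bar> \<le> (if l = i then 3 * r / 4 else 0) + \<delta>"
          using r(1) \<delta> by (auto split: if_splits)
      qed
      also have "\<dots> = 3 * r / 4 + real CARD('n) * \<delta>"
        by (simp add: sum.distrib)
      also have "\<dots> < 1"
        using r by (simp add: \<delta>_def)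
      finally show "z \<in> ?B"
        by simp
    qed
    have le: "AE z in lebesgue_on ?B. indicator E z * (b k / 6) powr p \<le> ?F z"
      using weak_hessian_AE[OF open_ball series.weak_hessian_u]
    proof eventually_elim
      case (elim z)
      show ?case
      proof (cases "z \<in> E")
        case True
        then have z: "r / 2 \<le> z $ i" "z $ i \<le> 3 * r / 4" "1 / 2 \<le> cos (z $ j / r)"
          by (auto simp: E_def dest: spec[of _ i])
        have "2 * radius (Suc k) < z $ i" "z $ i < radius k"
          using z r(1) radius_Suc_le[of k] by (simp_all add: r_def)
        then have "b k / 6 \<le> norm (matrix_pos_part (series.D2u z))"
          using norm_pos_part_ge z(3) unfolding b_def r_def by blast
        then have "(b k / 6) powr p \<le> norm (matrix_pos_part (series.D2u z)) powr p"
          using b[of k] p by (intro powr_mono2) auto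
        then show ?thesis
          using True elim by simp
      qed simp
    qed
    have indE: "integrable (lebesgue_on ?B) (\<lambda>z. indicator E z * (b k / 6) powr p)"
      and intE: "(LINT z|lebesgue_on ?B. indicator E z * (b k / 6) powr p) = measure lebesgue E * (b k / 6) powr p"
    proof -
      have ind: "indicator ?B z *\<^sub>R (indicator E z * (b k / 6) powr p) = indicator E z * (b k / 6) powr p" for z
        using sub by (auto simp: indicator_def)
      have "integrable lebesgue (\<lambda>z. indicator E z * (b k / 6) powr p)"
        using E(1) by (intro integrable_mult_left) (auto simp: fmeasurable_def)
      then show "integrable (lebesgue_on ?B) (\<lambda>z. indicator E z * (b k / 6) powr p)"
        by (subst integrable_restrict_space) (auto simp only: ind, simp)
      show "(LINT z|lebesgue_on ?B. indicator E z * (b k / 6) powr p) = measure lebesgue E * (b k / 6) powr p"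
        using E(1) by (subst integral_restrict_space) (simp, simp only: ind, simp)
    qed
    have "measure lebesgue E * (b k / 6) powr p \<le> integral\<^sup>L (lebesgue_on ?B) ?F"
      using integral_mono_AE[OF indE int le] unfolding intE .
    moreover have "r * K \<le> measure lebesgue E"
      using E(2) by (simp add: K_def)
    then have "r * K * (b k / 6) powr p \<le> measure lebesgue E * (b k / 6) powr p"
      by (rule mult_right_mono) simp
    ultimately show ?thesis
      by (simp add: r_def mult.commute)
  qed
  define I where "I = integral\<^sup>L (lebesgue_on ?B) ?F"
  have "filterlim (\<lambda>k. b k powr p * radius k) at_top sequentially"
    unfolding b_def by (rule amplitude_powr_at_top[OF p])
  then have large: "\<forall>\<^sub>F k in sequentially. I * (6 powr p / K) < b k powr p * radius k"
    unfolding filterlim_at_top_dense by blast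
  have "radius \<longlonglongrightarrow> 0"
  proof (rule tendsto_sandwich[OF always_eventually always_eventually tendsto_const LIMSEQ_power_zero[of "1 / 8 :: real"]])
    show "\<forall>k. radius k \<le> (1 / 8) ^ k"
      unfolding radius_def by (intro allI power_decreasing) (auto simp: power2_eq_square)
  qed (use radius_bounds in \<open>auto intro: less_imp_le\<close>)
  then have radius_lim: "(\<lambda>k. 3 * (pi / 2) * radius k) \<longlonglongrightarrow> 3 * (pi / 2) * 0"
    by (intro tendsto_intros)
  have small: "\<forall>\<^sub>F k in sequentially. 3 * (pi / 2) * radius k < \<delta> / 2"
    by (rule order_tendstoD(2)[OF radius_lim]) (use \<delta> in simp)
  have "\<forall>\<^sub>F k in sequentially. False"
    using large small eventually_ge_at_top[of 1]
  proof eventually_elim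
    case (elim k)
    have "(b k / 6) powr p * (radius k * K) \<le> I"
      unfolding I_def using elim by (intro bound) auto
    then have "b k powr p * radius k * (K / 6 powr p) \<le> I"
      using b[of k] by (simp add: powr_divide)
    then have "b k powr p * radius k \<le> I * (6 powr p / K)"
      using K by (simp add: field_simps)
    then show ?case
      using elim(1) by linarith
  qed
  then show False
    by simp
qed

end

theorem proposition4p1:
  assumes "CARD('n::finite) \<ge> 2"
  shows "\<exists>(g :: real^'n \<Rightarrow> real) \<phi> u.
    (\<exists>L. L-lipschitz_on (ball 0 1) \<phi>) \<and>
    obstacle_solution (ball 0 1) g \<phi> u \<and>
    u \<in> W2 1 (ball 0 1) \<and>
    (\<forall>p>1. (\<lambda>x. matrix_pos_part (weak_hessian (ball 0 1) u x)) \<notin> Lp_space p (ball 0 1))"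
proof -
  obtain i j :: 'n where ij: "i \<noteq> j"
  proof -
    have "\<not> is_singleton (UNIV :: 'n set)"
      using assms by (auto simp: is_singleton_altdef)
    then show thesis
      using that by (metis UNIV_I UNIV_eq_I is_singletonI singleton_iff)
  qed
  obtain w w' w'' M where "cutoff w w' w'' M"
    using cutoff_locale_exists by blast
  moreover obtain C where "\<forall>r>0. (LINT z|lebesgue_on (ball (0::real^'n) 1). soft_abs2 r (z $ i)) \<le> C"
    using soft_abs2_integral_bounded by blast
  ultimately interpret wave_series w w' w'' M i j C
    using ij by (auto simp: wave_series_def wave_def wave_axioms_def wave_series_axioms_def)
  show ?thesis
    using series.u_lipschitz series.u_obstacle_solution series.u_W2 pos_part_not_Lp by blast
qed

end
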